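(* For $d\ge0$, denote by $S_{d}$ the $\mathbb{Q}$-subspace of $\widehat{\mathfrak{H}}^{0}_{d}$ spanned by the elements $w*w'-w\mathbin{\mathrm{sh}}w'$, where $w$ and $w'$ are homogeneous elements of $\widehat{\mathfrak{H}}^{0}$ such that the sum of the weights of $w$ and $w'$ is equal to $d$. Then $S_{d}\subset\ker\bar{Z}_{q}$.
   Context: Fix a complex number $q$ with $0<|q|<1$ and set $[n]:=\frac{1-q^{n}}{1-q}$ for $n\ge 1$. Let $\hbar$ be a formal variable, $\mathcal{C}:=\mathbb{Q}[\hbar]$, and let $\mathfrak{H}$ be the non-commutative polynomial algebra over $\mathcal{C}$ freely generated by $x,y,\rho$. Set $\xi:=y-\rho$ and $z_{k}:=x^{k-1}y$ $(k\ge1)$. Let $\mathfrak{H}^{1}$ be the subalgebra of $\mathfrak{H}$ (freely) generated by the set $A:=\{\xi\}\cup\{z_{k}\}_{k\ge1}$, and let $\widehat{\mathfrak{H}}^{0}:=\mathcal{C}+\xi\mathfrak{H}^{1}+\sum_{k\ge2}z_{k}\mathfrak{H}^{1}$, a $\mathcal{C}$-submodule of $\mathfrak{H}^1$. $\mathbb{C}$ is regarded as a $\mathcal{C}$-module with $\hbar$ acting as multiplication by $1-q$. Let $\mathfrak{z}$ be the $\mathcal{C}$-submodule of $\mathfrak{H}$ generated by $A$. For $n\ge1$ let $u\mapsto I_{u}(n)$ be the $\mathcal{C}$-linear map $\mathfrak{z}\to\mathbb{C}$ with $I_{\xi}(n)=\frac{q^{n}}{[n]}$ and $I_{z_{k}}(n)=\frac{q^{(k-1)n}}{[n]^{k}}$.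 The $\mathcal{C}$-linear map $Z_{q}:\widehat{\mathfrak{H}}^{0}\to\mathbb{C}$ is defined by $Z_{q}(1)=1$ and, for a word $u_{1}\cdots u_{r}\in\widehat{\mathfrak{H}}^{0}$ with $r\ge1$, $u_{i}\in A$, by the absolutely convergent sum $Z_{q}(u_{1}\cdots u_{r})=\sum_{n_{1}>\cdots>n_{r}>0}\prod_{i=1}^{r}I_{u_{i}}(n_{i})$. Harmonic product: let $\circ$ be the commutative $\mathcal{C}$-bilinear product on $\mathfrak{z}$ with $z_{k}\circ z_{l}=z_{k+l}+\hbar z_{k+l-1}$, $\xi\circ z_{k}=z_{k+1}$, $\xi\circ\xi=z_{2}-\hbar\xi$ for $k,l\ge1$. The $\mathcal{C}$-bilinear product $*$ on $\mathfrak{H}^{1}$ is defined inductively by $1*w=w*1=w$ and $(u_{1}w)*(u_{2}w')=u_{1}(w*u_{2}w')+u_{2}(u_{1}w*w')+(u_{1}\circ u_{2})(w*w')$ for $w,w'\in\mathfrak{H}^{1}$, $u_{1},u_{2}\in A$. Integral shuffle product: the $\mathcal{C}$-bilinear product $\mathrm{sh}$ on $\mathfrak{H}$ is defined inductively by $1\mathbin{\mathrm{sh}}w=w\mathbin{\mathrm{sh}}1=w$ and, for $u,v\in\{x,y,\rho\}$ and $w,w'\in\mathfrak{H}$, $uw\mathbin{\mathrm{sh}}vw'=u(w\mathbin{\mathrm{sh}}vw')+v(uw\mathbin{\mathrm{sh}}w')+\alpha(u,v)(w\mathbin{\mathrm{sh}}w')$, where $\alpha(x,x)=\hbar x$, $\alpha(x,y)=\alpha(y,x)=0$,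 $\alpha(y,y)=-y\rho$, and $\alpha(u,\rho)=\alpha(\rho,u)=-u\rho$ for $u\in\{x,y,\rho\}$. The submodule $\widehat{\mathfrak{H}}^{0}$ is closed under both $*$ and $\mathrm{sh}$. Weight: $\widehat{\mathfrak{H}}^{0}$ is a graded $\mathbb{Q}$-module by giving each of $x,y,\rho$ and $\hbar$ degree one; this degree is called the weight, and $\widehat{\mathfrak{H}}^{0}_{d}$ is the homogeneous component of weight $d$. The $\mathbb{Q}$-linear map $\bar{Z}_{q}:\widehat{\mathfrak{H}}^{0}\to\mathbb{C}$ is defined by $\bar{Z}_{q}(w):=(1-q)^{-d}Z_{q}(w)$ for $w\in\widehat{\mathfrak{H}}^{0}_{d}$. *)

theory Defs
  imports
    "HOL-Analysis.Analysis"
    "HOL-Library.Poly_Mapping"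
    "HOL-Computational_Algebra.Polynomial"
begin

(* With lists as the (additively written) free monoid, 'a list =>_0 R with the
   convolution product of Poly_Mapping is the free associative R-algebra on 'a. *)

instantiation list :: (type) monoid_add
begin
definition zero_list :: "'a list" where "zero_list = []"
definition plus_list :: "'a list \<Rightarrow> 'a list \<Rightarrow> 'a list" where "plus_list = (@)"
instance by standard (simp_all add: zero_list_def plus_list_def)
end

type_synonym cring = "rat poly"

datatype letter = LX | LY | LRho

type_synonym halg = "letter list \<Rightarrow>\<^sub>0 cring"

definition cst :: "cring \<Rightarrow> 'a list \<Rightarrow>\<^sub>0 cring"
  where "cst c = Poly_Mapping.single [] c"

definition hbar :: halg
  where "hbar = cst [:0, 1:]"

definition letter_val :: "letter \<Rightarrow> halg"
  where "letter_val a = Poly_Mapping.single [a] 1"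

definition x :: halg where "x = letter_val LX"
definition y :: halg where "y = letter_val LY"
definition rho :: halg where "rho = letter_val LRho"
definition xi :: halg where "xi = y - rho"

(* only meant for k >= 1 *)
definition z :: "nat \<Rightarrow> halg" where "z k = x ^ (k - 1) * y"

hide_const (open) x y z

(* The extension of a function on words to a linear map over Q[hbar]. *)
definition lin_ext :: "('a list \<Rightarrow> halg) \<Rightarrow> ('a list \<Rightarrow>\<^sub>0 cring) \<Rightarrow> halg"
  where "lin_ext F f = (\<Sum>w\<in>Poly_Mapping.keys f. cst (Poly_Mapping.lookup f w) * F w)"

definition gen_set :: "halg set"
  where "gen_set = {xi} \<union> {Defs.z k |k. k \<ge> 1}"

inductive_set H1 :: "halg set" where
  H1_const: "cst c \<in> H1"
| H1_gen: "a \<in> gen_set \<Longrightarrow> a \<in> H1"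
| H1_add: "f \<in> H1 \<Longrightarrow> g \<in> H1 \<Longrightarrow> f + g \<in> H1"
| H1_mult: "f \<in> H1 \<Longrightarrow> g \<in> H1 \<Longrightarrow> f * g \<in> H1"

definition H0hat :: "halg set"
  where "H0hat = {cst c + xi * u + (\<Sum>k=2..m. Defs.z k * v k) |c u v m.
                    u \<in> H1 \<and> (\<forall>k. v k \<in> H1)}"

(* Formal names of the generators of H1. The index is shifted so that every name
   denotes a generator: GZ k stands for z_(k+1). *)
datatype gen = GXi | GZ nat

fun gen_val :: "gen \<Rightarrow> halg" where
  "gen_val GXi = xi"
| "gen_val (GZ k) = Defs.z (Suc k)"

definition gen_word :: "gen list \<Rightarrow> halg"
  where "gen_word w = prod_list (map gen_val w)"

(* H1 is freely generated by xi and the z_k, i.e. lin_ext gen_word is a bijection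
   onto H1 (gen_word_bij below); coords is the inverse map. *)
definition coords :: "halg \<Rightarrow> (gen list \<Rightarrow>\<^sub>0 cring)"
  where "coords = inv_into UNIV (lin_ext gen_word)"

definition qnum :: "complex \<Rightarrow> nat \<Rightarrow> complex"
  where "qnum q n = (1 - q ^ n) / (1 - q)"

definition ceval :: "complex \<Rightarrow> cring \<Rightarrow> complex"
  where "ceval q p = poly (map_poly of_rat p) (1 - q)"

fun Igen :: "complex \<Rightarrow> gen \<Rightarrow> nat \<Rightarrow> complex" where
  "Igen q GXi n = q ^ n / qnum q n"
| "Igen q (GZ k) n = q ^ (k * n) / qnum q n ^ Suc k"

definition Zword :: "complex \<Rightarrow> gen list \<Rightarrow> complex"
  where "Zword q us =
    (\<Sum>\<^sub>\<infinity>ns\<in>{ns. length ns = length us \<and> sorted_wrt (>) ns \<and> (\<forall>n\<in>set ns. n > 0)}.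
       \<Prod>i<length us. Igen q (us ! i) (ns ! i))"

definition Zq :: "complex \<Rightarrow> halg \<Rightarrow> complex"
  where "Zq q f = (\<Sum>w\<in>Poly_Mapping.keys (coords f).
                     ceval q (Poly_Mapping.lookup (coords f) w) * Zword q w)"

fun circ :: "gen \<Rightarrow> gen \<Rightarrow> halg" where
  "circ (GZ k) (GZ l) = Defs.z (Suc k + Suc l) + hbar * Defs.z (Suc k + Suc l - 1)"
| "circ GXi (GZ k) = Defs.z (Suc k + 1)"
| "circ (GZ k) GXi = Defs.z (Suc k + 1)"
| "circ GXi GXi = Defs.z 2 - hbar * xi"

fun star_word :: "gen list \<Rightarrow> gen list \<Rightarrow> halg" where
  "star_word [] v = gen_word v"
| "star_word u [] = gen_word u"
| "star_word (a # u) (b # v) =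
     gen_val a * star_word u (b # v) + gen_val b * star_word (a # u) v + circ a b * star_word u v"

definition star :: "halg \<Rightarrow> halg \<Rightarrow> halg"
  where "star f g = lin_ext (\<lambda>u. lin_ext (star_word u) (coords g)) (coords f)"

fun alpha :: "letter \<Rightarrow> letter \<Rightarrow> halg" where
  "alpha LX LX = hbar * Defs.x"
| "alpha LX LY = 0"
| "alpha LY LX = 0"
| "alpha LY LY = - (Defs.y * rho)"
| "alpha u LRho = - (letter_val u * rho)"
| "alpha LRho u = - (letter_val u * rho)"

fun sh_word :: "letter list \<Rightarrow> letter list \<Rightarrow> halg" where
  "sh_word [] w = Poly_Mapping.single w 1"
| "sh_word w [] = Poly_Mapping.single w 1"
| "sh_word (u # w) (v # w') =
     letter_val u * sh_word w (v # w') + letter_val v * sh_word (u # w) w' + alpha u v * sh_word w w'"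

definition sh :: "halg \<Rightarrow> halg \<Rightarrow> halg"
  where "sh f g = lin_ext (\<lambda>u. lin_ext (sh_word u) g) f"

(* The component of weight d: a word of length l contributes the term hbar^(d-l). *)
definition wt_comp :: "nat \<Rightarrow> halg \<Rightarrow> halg"
  where "wt_comp d f = (\<Sum>w\<in>{w\<in>Poly_Mapping.keys f. length w \<le> d}.
           Poly_Mapping.single w
             (monom (coeff (Poly_Mapping.lookup f w) (d - length w)) (d - length w)))"

definition H0hat_wt :: "nat \<Rightarrow> halg set"
  where "H0hat_wt d = {f\<in>H0hat. \<forall>w i. coeff (Poly_Mapping.lookup f w) i \<noteq> 0 \<longrightarrow> length w + i = d}"

definition Zbar :: "complex \<Rightarrow> halg \<Rightarrow> complex"
  where "Zbar q f = (\<Sum>d\<in>{d. wt_comp d f \<noteq> 0}. Zq q (wt_comp d f) / (1 - q) ^ d)"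

definition ker_Zbar :: "complex \<Rightarrow> halg set"
  where "ker_Zbar q = {f\<in>H0hat. Zbar q f = 0}"

definition qscale :: "rat \<Rightarrow> halg \<Rightarrow> halg"
  where "qscale c f = cst [:c:] * f"


lemma cst_single: "cst c * Poly_Mapping.single w a = Poly_Mapping.single w (c * a)"
  by (simp add: cst_def mult_single plus_list_def)

lemma cst_0 [simp]: "cst 0 = 0" and cst_1 [simp]: "cst 1 = 1"
  by (simp_all add: cst_def zero_list_def [symmetric])

lemma single_Nil_1 [simp]: "Poly_Mapping.single [] (1::cring) = 1"
  using cst_1 by (simp only: cst_def)

lemma cst_add: "cst (a + b) = cst a + cst b"
  by (simp add: cst_def single_add)

lemma cst_mult: "cst (a * b) = cst a * cst b"
  by (simp add: cst_def mult_single plus_list_def)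

global_interpretation HQ: vector_space qscale
proof
  fix a b :: rat and f :: halg
  have "cst [:a + b:] = cst [:a:] + (cst [:b:] :: halg)"
    by (simp add: cst_add [symmetric])
  then show "qscale (a + b) f = qscale a f + qscale b f"
    by (simp add: qscale_def distrib_right)
  have "cst ([:a:] * [:b:]) = cst [:a:] * (cst [:b:] :: halg)"
    by (rule cst_mult)
  then show "qscale a (qscale b f) = qscale (a * b) f"
    by (simp add: qscale_def mult.assoc [symmetric] mult.commute [of b a])
qed (simp_all add: qscale_def distrib_left one_pCons [symmetric])

definition S_space :: "nat \<Rightarrow> halg set"
  where "S_space d = HQ.span {star w w' - sh w w' |w w'. \<exists>a b.
           w \<in> H0hat_wt a \<and> w' \<in> H0hat_wt b \<and> a + b = d}"


lemma pm_decomp: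
  "f = (\<Sum>w\<in>Poly_Mapping.keys f. Poly_Mapping.single w (Poly_Mapping.lookup f w))"
  by (rule poly_mapping_eqI)
     (auto simp: lookup_sum lookup_single when_def in_keys_iff)

lemma pm_induct [case_names zero add single]:
  fixes f :: "'a \<Rightarrow>\<^sub>0 'b::comm_monoid_add"
  assumes z: "P 0" and a: "\<And>f g. P f \<Longrightarrow> P g \<Longrightarrow> P (f + g)"
    and s: "\<And>w c. P (Poly_Mapping.single w c)"
  shows "P f"
proof -
  have "P (\<Sum>w\<in>W. Poly_Mapping.single w (Poly_Mapping.lookup f w))" if "finite W" for W
    using that by (induction W) (auto intro: z a s)
  then show ?thesis using pm_decomp [of f] by (metis finite_keys)
qed

lemma cst_commute: "cst c * f = f * cst c"
proof (induction f rule: pm_induct)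
  case (single w d)
  then show ?case by (simp add: cst_def mult_single plus_list_def mult.commute)
qed (simp_all add: algebra_simps)

lemma lin_ext_superset:
  assumes "finite W" "Poly_Mapping.keys f \<subseteq> W"
  shows "lin_ext F f = (\<Sum>w\<in>W. cst (Poly_Mapping.lookup f w) * F w)"
  unfolding lin_ext_def
  by (rule sum.mono_neutral_left) (use assms in \<open>auto simp: in_keys_iff\<close>)

lemma lin_ext_0 [simp]: "lin_ext F 0 = 0"
  by (simp add: lin_ext_def)

lemma lin_ext_add: "lin_ext F (f + g) = lin_ext F f + lin_ext F g"
proof -
  let ?W = "Poly_Mapping.keys f \<union> Poly_Mapping.keys g"
  have "Poly_Mapping.keys (f + g) \<subseteq> ?W" by (rule keys_add)
  then show ?thesis
    by (simp add: lin_ext_superset [of ?W] lookup_add cst_add algebra_simps sum.distrib)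
qed

lemma lin_ext_single: "lin_ext F (Poly_Mapping.single w c) = cst c * F w"
  by (subst lin_ext_superset [of "{w}"]) (auto simp: lookup_single when_def split: if_splits)

lemma lin_ext_cst_mult: "lin_ext F (cst c * f) = cst c * lin_ext F f"
proof (induction f rule: pm_induct)
  case (single w d)
  then show ?case by (simp add: cst_single lin_ext_single cst_mult mult.assoc)
qed (simp_all add: distrib_left lin_ext_add)

lemma lin_ext_diff: "lin_ext F (f - g) = lin_ext F f - lin_ext F g"
  by (metis add_diff_cancel diff_add_cancel lin_ext_add)

definition subst_alg :: "('a \<Rightarrow> halg) \<Rightarrow> ('a list \<Rightarrow>\<^sub>0 cring) \<Rightarrow> halg"
  where "subst_alg g = lin_ext (\<lambda>w. prod_list (map g w))"

lemma subst_alg_mult: "subst_alg g (f * f') = subst_alg g f * subst_alg g f'"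
proof (induction f rule: pm_induct)
  case (single w c)
  show ?case
  proof (induction f' rule: pm_induct)
    case (single w' c')
    let ?p = "prod_list (map g w)" and ?p' = "prod_list (map g w')"
    have "cst (c * c') * (?p * ?p') = cst c * (cst c' * ?p) * ?p'"
      by (simp add: cst_mult mult.assoc)
    also have "\<dots> = cst c * ?p * (cst c' * ?p')"
      by (simp add: cst_commute [of c' ?p] mult.assoc)
    finally show ?case
      by (simp add: subst_alg_def mult_single plus_list_def lin_ext_single)
  qed (simp_all add: distrib_left lin_ext_add subst_alg_def)
qed (simp_all add: distrib_right lin_ext_add subst_alg_def)

lemma subst_alg_1 [simp]: "subst_alg g 1 = 1"
  using lin_ext_single [of "\<lambda>w. prod_list (map g w)" "[]" 1] by (simp add: subst_alg_def)

lemma subst_alg_prod_list: "subst_alg g (prod_list fs) = prod_list (map (subst_alg g) fs)"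
  by (induction fs) (simp_all add: subst_alg_mult)

lemma subst_alg_comp:
  "subst_alg g (subst_alg h f) = subst_alg (\<lambda>a. subst_alg g (h a)) f"
proof (induction f rule: pm_induct)
  case (single w c)
  have "subst_alg g (prod_list (map h w)) = prod_list (map (\<lambda>a. subst_alg g (h a)) w)"
    by (simp add: subst_alg_prod_list o_def)
  then show ?case
    by (simp add: subst_alg_def lin_ext_single lin_ext_cst_mult)
qed (simp_all add: subst_alg_def lin_ext_add)

lemma subst_alg_letter: "subst_alg g (letter_val a) = g a"
  by (simp add: subst_alg_def letter_val_def lin_ext_single)

lemma lin_ext_gen_word: "lin_ext gen_word = subst_alg gen_val"
  by (simp add: subst_alg_def gen_word_def [abs_def])

(* The involution rho -> y - rho maps the generators of H1 to single words. *)
fun phi :: "letter \<Rightarrow> halg" where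
  "phi LX = Defs.x" | "phi LY = Defs.y" | "phi LRho = Defs.y - rho"

fun code_of :: "gen \<Rightarrow> letter list" where
  "code_of GXi = [LRho]" | "code_of (GZ k) = replicate k LX @ [LY]"

lemma x_power: "Defs.x ^ k = Poly_Mapping.single (replicate k LX) 1"
  by (induction k)
     (simp_all add: Defs.x_def letter_val_def mult_single plus_list_def)

lemma subst_phi_gen: "subst_alg phi (gen_val a) = Poly_Mapping.single (code_of a) 1"
proof (cases a)
  case GXi
  then show ?thesis
    unfolding xi_def gen_val.simps GXi
    by (simp add: subst_alg_def lin_ext_diff,
        simp add: subst_alg_def [symmetric] Defs.y_def rho_def subst_alg_letter)
       (simp add: letter_val_def)
next
  case (GZ k)
  have "subst_alg phi (Defs.x ^ k) = Defs.x ^ k" for k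
    by (induction k) (simp_all add: subst_alg_mult, simp add: Defs.x_def subst_alg_letter)
  then have "subst_alg phi (gen_val a) = Defs.x ^ k * Defs.y"
    by (simp add: GZ Defs.z_def subst_alg_mult, simp add: Defs.y_def subst_alg_letter)
  then show ?thesis
    by (simp add: GZ x_power Defs.y_def letter_val_def mult_single plus_list_def)
qed

lemma code_of_cancel:
  assumes "code_of a @ u = code_of b @ v"
  shows "a = b \<and> u = v"
proof -
  have *: "replicate k LX @ LY # u = replicate l LX @ LY # v \<Longrightarrow> k = l \<and> u = v" for k l u v
  proof (induction k arbitrary: l)
    case 0 then show ?case by (cases l) auto
  next
    case (Suc k) then show ?case by (cases l) auto
  qed
  have **: "LRho # u \<noteq> replicate l LX @ LY # v" "replicate l LX @ LY # v \<noteq> LRho # u" for u v l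
    by (cases l; simp)+
  show ?thesis
    using assms by (cases a; cases b) (auto simp: ** dest: *)
qed

lemma code_inj: "inj (\<lambda>w. concat (map code_of w))"
proof (rule injI)
  fix u v assume "concat (map code_of u) = concat (map code_of v)"
  then show "u = v"
  proof (induction u arbitrary: v)
    case Nil
    have "code_of a \<noteq> []" for a by (cases a) auto
    with Nil show ?case by (cases v) auto
  next
    case (Cons a u)
    have "code_of a \<noteq> []" by (cases a) auto
    with Cons.prems obtain b v' where v: "v = b # v'" by (cases v) auto
    with Cons.prems have "a = b \<and> concat (map code_of u) = concat (map code_of v')"
      by (intro code_of_cancel) simp
    with Cons.IH v show ?case by blast
  qed
qed

lemma prod_list_single:
  "prod_list (map (\<lambda>a. Poly_Mapping.single (h a) (1::cring)) w)
     = Poly_Mapping.single (concat (map h w)) 1"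
  by (induction w) (simp_all add: mult_single plus_list_def)

lemma lookup_subst_phi:
  "Poly_Mapping.lookup (subst_alg phi (lin_ext gen_word f)) (concat (map code_of w))
     = Poly_Mapping.lookup f w"
proof -
  have "subst_alg phi (lin_ext gen_word f)
      = lin_ext (\<lambda>w. Poly_Mapping.single (concat (map code_of w)) 1) f"
    unfolding lin_ext_gen_word subst_alg_comp subst_phi_gen
    by (simp add: subst_alg_def prod_list_single)
  moreover have "Poly_Mapping.lookup (lin_ext (\<lambda>w. Poly_Mapping.single (concat (map code_of w)) 1) f)
      (concat (map code_of w)) = Poly_Mapping.lookup f w"
    by (induction f rule: pm_induct)
       (simp_all add: lin_ext_add lookup_add lin_ext_single cst_single lookup_single
          inj_eq [OF code_inj])
  ultimately show ?thesis by simp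
qed

lemma range_gen_word: "range (lin_ext gen_word) = H1"
proof
  have gv: "gen_val a \<in> gen_set" for a
    by (cases a) (auto simp: gen_set_def)
  have one: "1 \<in> H1" and zero: "0 \<in> H1"
    by (metis H1_const cst_1, metis H1_const cst_0)
  have "gen_word w \<in> H1" for w
    by (induction w) (auto simp: gen_word_def one intro: H1.intros gv)
  then have "lin_ext gen_word f \<in> H1" for f
    by (induction f rule: pm_induct)
       (auto simp: lin_ext_add lin_ext_single zero intro: H1.intros)
  then show "range (lin_ext gen_word) \<subseteq> H1" by auto
next
  have "\<exists>g. f = lin_ext gen_word g" if "f \<in> H1" for f
    using that
  proof induction
    case (H1_const c)
    have "cst c = lin_ext gen_word (cst c)"
      unfolding cst_def [of c, where 'a = gen] lin_ext_single by (simp add: gen_word_def)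
    then show ?case ..
  next
    case (H1_gen a)
    then consider "a = xi" | k where "a = Defs.z k" "k \<ge> 1"
      by (auto simp: gen_set_def)
    then obtain u where "a = gen_val u"
    proof cases
      case 1
      then show thesis using that [of GXi] by simp
    next
      case (2 k)
      then show thesis using that [of "GZ (k - 1)"] by simp
    qed
    then have "a = lin_ext gen_word (Poly_Mapping.single [u] 1)"
      by (simp add: lin_ext_single gen_word_def)
    then show ?case ..
  next
    case (H1_add f g)
    then obtain f' g' where "f = lin_ext gen_word f'" "g = lin_ext gen_word g'" by blast
    then have "f + g = lin_ext gen_word (f' + g')" by (simp add: lin_ext_add)
    then show ?case ..
  next
    case (H1_mult f g)
    then obtain f' g' where "f = lin_ext gen_word f'" "g = lin_ext gen_word g'" by blast
    then have "f * g = lin_ext gen_word (f' * g')" by (simp add: lin_ext_gen_word subst_alg_mult)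
    then show ?case ..
  qed
  then show "H1 \<subseteq> range (lin_ext gen_word)" by auto
qed

lemma gen_word_bij: "bij_betw (lin_ext gen_word) UNIV H1"
  unfolding bij_betw_def
proof
  show "inj (lin_ext gen_word)"
  proof (rule injI, rule poly_mapping_eqI)
    fix f g w
    assume "lin_ext gen_word f = lin_ext gen_word g"
    then show "Poly_Mapping.lookup f w = Poly_Mapping.lookup g w"
      using lookup_subst_phi [of f w] lookup_subst_phi [of g w] by simp
  qed
qed (rule range_gen_word)

lemma coords_lin_ext [simp]: "coords (lin_ext gen_word f) = f"
  using gen_word_bij by (simp add: coords_def bij_betw_def)

lemma lin_ext_coords: "f \<in> H1 \<Longrightarrow> lin_ext gen_word (coords f) = f"
  unfolding coords_def by (rule f_inv_into_f) (simp add: range_gen_word)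

lemma wt_comp_homogeneous:
  assumes "f \<in> H0hat_wt d"
  shows "wt_comp e f = (if e = d then f else 0)"
proof (rule poly_mapping_eqI, rule poly_eqI)
  fix w i
  have h: "coeff (Poly_Mapping.lookup f w) i = 0 \<or> length w + i = d" for w i
    using assms by (auto simp: H0hat_wt_def)
  have "Poly_Mapping.lookup (wt_comp e f) w
     = (if w \<in> Poly_Mapping.keys f \<and> length w \<le> e
        then monom (coeff (Poly_Mapping.lookup f w) (e - length w)) (e - length w) else 0)"
    by (simp add: wt_comp_def lookup_sum lookup_single when_def)
  then show "coeff (Poly_Mapping.lookup (wt_comp e f) w) i
     = coeff (Poly_Mapping.lookup (if e = d then f else 0) w) i"
    using h[of w i] h[of w "e - length w"]
    by (auto simp: in_keys_iff)
qed

lemma Zbar_homogeneous: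
  assumes "f \<in> H0hat_wt d"
  shows "Zbar q f = Zq q f / (1 - q) ^ d"
proof -
  have [simp]: "Zq q 0 = 0"
    using coords_lin_ext [of 0] by (simp add: Zq_def)
  show ?thesis
    by (cases "f = 0")
       (simp add: Zbar_def wt_comp_def, simp add: Zbar_def wt_comp_homogeneous [OF assms])
qed

end

(* The letters act on power series in t: x and y by Jackson integration against dt/t and dt/(1-t),
   rho by multiplication with (1-q) t/(1-t). Applying a word to 1 turns sh into the ordinary product
   of series, and for w = u_1 ... u_r in H1 the coefficient of t^n is the part of the multiple sum
   with n_1 = n. The partial sums of these coefficients turn * into the ordinary product. On H0hat
   the coefficients are absolutely summable with sum Z_q, so Z_q is multiplicative for both products:
   by the Cauchy product for sh, and as a limit of partial sums for *. *)

theory Submission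
  imports Defs
begin

section \<open>Submodules and weights\<close>

text \<open>The correction terms of \<open>sh\<close> have one origin. \<open>x\<close> acts as a
  Jackson sum over the points q t, q^2 t, ..., whereas \<open>y\<close> multiplies by t/(1-t) and
  then sums over t, q t, .... In a product of two such sums the pairs of indices are sorted by which
  index is larger: the diagonal is missed for x with x (correction hbar x), counted twice for y with
  y (correction -y rho) and met exactly once for x with y. These identities require positive
  exponents, so x may act only on series without constant term. The product rule is therefore proved
  for words of \<open>H1\<close>. As \<open>sh\<close> recurses on letters while \<open>H1\<close>
  and \<open>H0hat\<close> are given by generators, both have to be redescribed by letters. The
  inner letter z 1 has no decaying factor; only the first letter of an admissible word forces
  convergence. Limits are hence taken on \<open>H0hat\<close> alone, after its closure under both
  products is known. Finally, \<open>Zbar\<close> rescales each weight by its own power of 1 - q, so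
  vanishing of \<open>Zq\<close> suffices only for homogeneous elements; this is why weights are
  tracked through both products.\<close>

definition submodule :: "('a list \<Rightarrow>\<^sub>0 cring) set \<Rightarrow> bool" where
  "submodule K \<longleftrightarrow> 0 \<in> K \<and> (\<forall>f\<in>K. \<forall>g\<in>K. f + g \<in> K) \<and> (\<forall>c. \<forall>f\<in>K. cst c * f \<in> K)"

lemma submodule_0: "submodule K \<Longrightarrow> 0 \<in> K"
  and submodule_add: "submodule K \<Longrightarrow> f \<in> K \<Longrightarrow> g \<in> K \<Longrightarrow> f + g \<in> K"
  and submodule_cst: "submodule K \<Longrightarrow> f \<in> K \<Longrightarrow> cst c * f \<in> K"
  by (auto simp: submodule_def)

lemma submodule_uminus:
  fixes f :: "'a list \<Rightarrow>\<^sub>0 cring"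
  assumes "submodule K" "f \<in> K" shows "- f \<in> K"
proof -
  have "cst (- 1) + cst 1 = (0 :: 'a list \<Rightarrow>\<^sub>0 cring)"
    by (simp only: cst_add [symmetric]) simp
  then have "cst (- 1) = (- 1 :: 'a list \<Rightarrow>\<^sub>0 cring)"
    by (simp add: eq_neg_iff_add_eq_0)
  then show ?thesis using submodule_cst [OF assms, of "- 1"] by simp
qed

lemma submodule_diff: "submodule K \<Longrightarrow> f \<in> K \<Longrightarrow> g \<in> K \<Longrightarrow> f - g \<in> K"
  using submodule_add [of K f "- g"] submodule_uminus [of K g] by simp

lemma submodule_sum:
  assumes "submodule K" "\<And>i. i \<in> I \<Longrightarrow> f i \<in> K"
  shows "(\<Sum>i\<in>I. f i) \<in> K"
  using assms(2) by (induction I rule: infinite_finite_induct)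
    (auto intro: submodule_0 submodule_add assms(1))

lemma submodule_lin_ext:
  "submodule K \<Longrightarrow> (\<And>w. w \<in> Poly_Mapping.keys f \<Longrightarrow> F w \<in> K) \<Longrightarrow> lin_ext F f \<in> K"
  unfolding lin_ext_def by (intro submodule_sum submodule_cst)

lemma cst_left_commute: "f * (cst c * g) = cst c * (f * g)"
  by (metis cst_commute mult.assoc)

lemma hbar_left_commute: "f * (hbar * g) = hbar * (f * g)"
  by (simp add: hbar_def cst_left_commute)

lemma single_eq_cst: "Poly_Mapping.single w c = cst c * Poly_Mapping.single w 1"
  by (simp add: cst_single)

text \<open>In contrast to \<open>pm_induct\<close>, the base case knows that the word lies in the
  support of \<open>f\<close>, so facts about that support survive the reduction, and scalars are
  split off.\<close>

lemma linear_induct [case_names zero add cst word]: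
  fixes f :: "'a list \<Rightarrow>\<^sub>0 cring"
  assumes "P 0" "\<And>f g. P f \<Longrightarrow> P g \<Longrightarrow> P (f + g)" "\<And>c f. P f \<Longrightarrow> P (cst c * f)"
    and "\<And>w. w \<in> Poly_Mapping.keys f \<Longrightarrow> P (Poly_Mapping.single w 1)"
  shows "P f"
proof -
  have "P (\<Sum>w\<in>W. Poly_Mapping.single w (Poly_Mapping.lookup f w))"
    if "W \<subseteq> Poly_Mapping.keys f" for W
    using finite_subset [OF that finite_keys] that
    by (induction W) (auto intro!: assms simp: single_eq_cst [of _ "Poly_Mapping.lookup f _"])
  from this [OF subset_refl] show ?thesis using pm_decomp [of f] by simp
qed

lemma letter_val_single: "letter_val a * Poly_Mapping.single w c = Poly_Mapping.single (a # w) c"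
  by (simp add: letter_val_def mult_single plus_list_def)

lemma lin_ext_fun_add: "lin_ext (\<lambda>w. F w + G w) f = lin_ext F f + lin_ext G f"
  by (simp add: lin_ext_def distrib_left sum.distrib)

lemma lin_ext_fun_cst: "lin_ext (\<lambda>w. cst c * F w) f = cst c * lin_ext F f"
  unfolding lin_ext_def sum_distrib_left by (intro sum.cong refl cst_left_commute)

section \<open>Homogeneous elements and the weight of the shuffle product\<close>

definition homogeneous :: "nat \<Rightarrow> halg \<Rightarrow> bool" where
  "homogeneous d f \<longleftrightarrow>
     (\<forall>w i. coeff (Poly_Mapping.lookup f w) i \<noteq> 0 \<longrightarrow> length w + i = d)"

lemma H0hat_wt_iff: "f \<in> H0hat_wt d \<longleftrightarrow> f \<in> H0hat \<and> homogeneous d f"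
  by (simp add: H0hat_wt_def homogeneous_def)

lemma homogeneous_0: "homogeneous d 0"
  by (simp add: homogeneous_def)

lemma homogeneous_add: "homogeneous d f \<Longrightarrow> homogeneous d g \<Longrightarrow> homogeneous d (f + g)"
  unfolding homogeneous_def lookup_add coeff_add by (metis add_0)

lemma homogeneous_uminus: "homogeneous d f \<Longrightarrow> homogeneous d (- f)"
  by (simp add: homogeneous_def)

lemma homogeneous_diff: "homogeneous d f \<Longrightarrow> homogeneous d g \<Longrightarrow> homogeneous d (f - g)"
  using homogeneous_add [of d f "- g"] by (simp add: homogeneous_uminus)

lemma homogeneous_sum: "(\<And>i. i \<in> I \<Longrightarrow> homogeneous d (f i)) \<Longrightarrow> homogeneous d (\<Sum>i\<in>I. f i)"
  by (induction I rule: infinite_finite_induct) (auto intro: homogeneous_0 homogeneous_add)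

lemma homogeneous_single:
  "(\<And>i. coeff c i \<noteq> 0 \<Longrightarrow> length w + i = d) \<Longrightarrow> homogeneous d (Poly_Mapping.single w c)"
  by (auto simp: homogeneous_def lookup_single when_def)

lemma homogeneous_monom: "homogeneous (length w + i) (Poly_Mapping.single w (monom c i))"
  by (rule homogeneous_single) (auto split: if_splits)

text \<open>The weight fixes the power of hbar that a given word may carry, so each coefficient of a
  homogeneous element is a single monomial.\<close>

lemma homogeneous_induct [consumes 1, case_names zero add single]:
  assumes "homogeneous d f"
    and "P 0" "\<And>f g. P f \<Longrightarrow> P g \<Longrightarrow> P (f + g)"
    and "\<And>w i c. length w + i = d \<Longrightarrow> P (Poly_Mapping.single w (monom c i))"
  shows "P f"
proof -
  have *: "P (Poly_Mapping.single w (Poly_Mapping.lookup f w))" if "w \<in> Poly_Mapping.keys f" for w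
  proof -
    let ?p = "Poly_Mapping.lookup f w"
    have "?p \<noteq> 0" using that by (simp add: in_keys_iff)
    then obtain i where i: "coeff ?p i \<noteq> 0" by (metis leading_coeff_0_iff)
    have "length w + j = d" if "coeff ?p j \<noteq> 0" for j
      using assms(1) that by (auto simp: homogeneous_def)
    then have "length w + i = d" "?p = monom (coeff ?p i) i"
      using i by (auto intro!: poly_eqI) (metis add_left_cancel)
    then show ?thesis using assms(4) by metis
  qed
  have "P (\<Sum>w\<in>W. Poly_Mapping.single w (Poly_Mapping.lookup f w))"
    if "W \<subseteq> Poly_Mapping.keys f" for W
    using finite_subset [OF that finite_keys] that
    by (induction W) (auto intro!: assms(2,3) *)
  from this [OF subset_refl] show ?thesis using pm_decomp [of f] by simp
qed

lemma homogeneous_mult: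
  assumes "homogeneous a f" "homogeneous b g"
  shows "homogeneous (a + b) (f * g)"
  using assms(1)
proof (induction rule: homogeneous_induct)
  case f: (single w i c)
  show ?case using assms(2)
  proof (induction rule: homogeneous_induct)
    case (single v j e)
    have "a + b = length (w @ v) + (i + j)" using f single by simp
    then show ?case using homogeneous_monom [of "w @ v" "i + j" "c * e"]
      by (simp add: mult_single mult_monom plus_list_def)
  qed (auto simp: distrib_left intro: homogeneous_0 homogeneous_add)
qed (auto simp: distrib_right intro: homogeneous_0 homogeneous_add)

lemma homogeneous_letter: "homogeneous (Suc 0) (letter_val a)"
  unfolding letter_val_def by (rule homogeneous_single) (auto split: if_splits)

lemma homogeneous_hbar: "homogeneous (Suc 0) hbar"
  unfolding hbar_def cst_def
  by (rule homogeneous_single) (auto simp: coeff_pCons split: nat.splits)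

lemma homogeneous_1: "homogeneous 0 1"
  using homogeneous_monom [of "[]" 0 1] by simp

lemmas homogeneous_x = homogeneous_letter [of LX, folded Defs.x_def]
lemmas homogeneous_y = homogeneous_letter [of LY, folded Defs.y_def]
lemmas homogeneous_rho = homogeneous_letter [of LRho, folded rho_def]

lemma homogeneous_xi: "homogeneous (Suc 0) xi"
  unfolding xi_def by (intro homogeneous_diff homogeneous_y homogeneous_rho)

lemma homogeneous_z: "homogeneous (Suc k) (Defs.z (Suc k))"
proof -
  have "homogeneous k (Defs.x ^ k)" for k
    by (induction k) (use homogeneous_mult [OF homogeneous_x] homogeneous_1 in auto)
  from homogeneous_mult [OF this homogeneous_y] show ?thesis by (simp add: Defs.z_def)
qed

text \<open>The weight \<open>wt\<close> is abstract because two alphabets are served: letter words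
  weighted by \<open>length\<close> and generator words weighted by \<open>gen_weight\<close>. The
  shift \<open>e\<close> carries the weight of the other factor of a product.\<close>

lemma homogeneous_lin_ext:
  fixes f :: "'a list \<Rightarrow>\<^sub>0 cring"
  assumes f: "\<And>w i. coeff (Poly_Mapping.lookup f w) i \<noteq> 0 \<Longrightarrow> wt w + i = d"
    and F: "\<And>w. homogeneous (wt w + e) (F w)"
  shows "homogeneous (d + e) (lin_ext F f)"
  unfolding lin_ext_def
proof (rule homogeneous_sum)
  fix w assume "w \<in> Poly_Mapping.keys f"
  then have "Poly_Mapping.lookup f w \<noteq> 0" by (simp add: in_keys_iff)
  then obtain i where i: "coeff (Poly_Mapping.lookup f w) i \<noteq> 0" by (metis leading_coeff_0_iff)
  have "homogeneous i (cst (Poly_Mapping.lookup f w))"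
    unfolding cst_def by (rule homogeneous_single) (use f [OF i] f [of w] in force)
  from homogeneous_mult [OF this F [of w]] f [OF i]
  show "homogeneous (d + e) (cst (Poly_Mapping.lookup f w) * F w)" by (simp add: ac_simps)
qed

lemma homogeneous_alpha: "homogeneous (Suc (Suc 0)) (alpha u v)"
proof -
  have "homogeneous (Suc (Suc 0)) (letter_val u * rho)" for u
    using homogeneous_mult [OF homogeneous_letter homogeneous_rho] by simp
  moreover have "homogeneous (Suc (Suc 0)) (hbar * Defs.x)"
    using homogeneous_mult [OF homogeneous_hbar homogeneous_x] by simp
  ultimately show ?thesis
    by (cases u; cases v) (auto simp: homogeneous_0 Defs.y_def intro!: homogeneous_uminus)
qed

lemma homogeneous_sh_word: "homogeneous (length u + length v) (sh_word u v)"
proof (induction u v rule: sh_word.induct)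
  case (3 u w v w')
  have "homogeneous (Suc 0 + (length w + length (v # w'))) (letter_val u * sh_word w (v # w'))"
    "homogeneous (Suc 0 + (length (u # w) + length w')) (letter_val v * sh_word (u # w) w')"
    "homogeneous (Suc (Suc 0) + (length w + length w')) (alpha u v * sh_word w w')"
    by (intro homogeneous_mult homogeneous_letter homogeneous_alpha 3)+
  then show ?case by (auto intro!: homogeneous_add)
next
  case (1 w)
  show ?case using homogeneous_monom [of w 0 1] by simp
next
  case (2 v w)
  show ?case using homogeneous_monom [of "v # w" 0 1] by simp
qed

lemma homogeneous_sh:
  assumes "homogeneous a f" "homogeneous b g"
  shows "homogeneous (a + b) (sh f g)"
  unfolding sh_def
proof (rule homogeneous_lin_ext [where wt = length])
  show "homogeneous (length u + b) (lin_ext (sh_word u) g)" for u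
  proof (subst add.commute, rule homogeneous_lin_ext [where wt = length])
    show "homogeneous (length v + length u) (sh_word u v)" for v
      using homogeneous_sh_word [of u v] by (simp add: add.commute)
  qed (use assms(2) in \<open>simp add: homogeneous_def\<close>)
qed (use assms(1) in \<open>simp add: homogeneous_def\<close>)

section \<open>Weights of generator words and of the harmonic product\<close>

definition gen_weight :: "gen list \<Rightarrow> nat" where
  "gen_weight w = length (concat (map code_of w))"

lemma gen_weight_simps [simp]:
  "gen_weight [] = 0" "gen_weight (GXi # w) = Suc (gen_weight w)"
  "gen_weight (GZ k # w) = Suc k + gen_weight w"
  by (simp_all add: gen_weight_def)

lemma gen_weight_Cons: "gen_weight (a # w) = gen_weight [a] + gen_weight w"
  by (simp add: gen_weight_def)

text \<open>\<open>phi\<close> preserves weight and turns each generator word into the single letter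
  word that codes it. The coefficients of \<open>coords f\<close> therefore reappear in
  \<open>subst_alg phi f\<close>, at words whose length is \<open>gen_weight\<close>.\<close>

lemma coords_weight:
  assumes "f \<in> H1" "homogeneous d f" "coeff (Poly_Mapping.lookup (coords f) w) i \<noteq> 0"
  shows "gen_weight w + i = d"
proof -
  have "homogeneous (Suc 0) (phi a)" for a
    by (cases a) (auto intro: homogeneous_x homogeneous_y homogeneous_xi [unfolded xi_def])
  then have "homogeneous (length w) (prod_list (map phi w))" for w
    by (induction w) (use homogeneous_mult [of "Suc 0"] homogeneous_1 in auto)
  then have "homogeneous (d + 0) (subst_alg phi f)"
    unfolding subst_alg_def
    by (intro homogeneous_lin_ext [where wt = length])
      (use assms(2) in \<open>auto simp: homogeneous_def\<close>)
  then show ?thesis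
    using lookup_subst_phi [of "coords f" w] assms(3)
    by (simp add: lin_ext_coords [OF assms(1)] homogeneous_def gen_weight_def)
qed

lemma homogeneous_gen: "homogeneous (gen_weight [a]) (gen_val a)"
  by (cases a) (use homogeneous_xi homogeneous_z in auto)

lemma homogeneous_circ: "homogeneous (gen_weight [a] + gen_weight [b]) (circ a b)"
proof -
  have *: "homogeneous (Suc (Suc (k + l))) (hbar * Defs.z (Suc (k + l)))" for k l
    using homogeneous_mult [OF homogeneous_hbar homogeneous_z [of "k + l"]] by simp
  have "homogeneous (Suc (Suc 0)) (hbar * xi)"
    using homogeneous_mult [OF homogeneous_hbar homogeneous_xi] by simp
  then show ?thesis
    using homogeneous_z [of 1] *
    by (cases a; cases b)
      (auto simp: numeral_2_eq_2 intro!: homogeneous_add homogeneous_diff homogeneous_z)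
qed

lemma homogeneous_gen_word: "homogeneous (gen_weight w) (gen_word w)"
proof (induction w)
  case Nil
  then show ?case by (simp add: gen_word_def homogeneous_1)
next
  case (Cons a w)
  with homogeneous_mult [OF homogeneous_gen this] show ?case
    by (simp add: gen_word_def gen_weight_Cons [of a w])
qed

lemma homogeneous_star_word: "homogeneous (gen_weight u + gen_weight v) (star_word u v)"
proof (induction u v rule: star_word.induct)
  case (3 a u b v)
  have "homogeneous (gen_weight [a] + (gen_weight u + gen_weight (b # v)))
      (gen_val a * star_word u (b # v))"
    "homogeneous (gen_weight [b] + (gen_weight (a # u) + gen_weight v))
      (gen_val b * star_word (a # u) v)"
    "homogeneous (gen_weight [a] + gen_weight [b] + (gen_weight u + gen_weight v))
      (circ a b * star_word u v)"
    by (intro homogeneous_mult homogeneous_gen homogeneous_circ 3)+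
  then show ?case
    by (auto simp: gen_weight_Cons [of a u] gen_weight_Cons [of b v] ac_simps
        intro!: homogeneous_add)
next
  case (1 v)
  show ?case using homogeneous_gen_word [of v] by simp
next
  case (2 a u)
  show ?case using homogeneous_gen_word [of "a # u"] by simp
qed

lemma homogeneous_star:
  assumes "f \<in> H1" "g \<in> H1" "homogeneous a f" "homogeneous b g"
  shows "homogeneous (a + b) (star f g)"
  unfolding star_def
proof (rule homogeneous_lin_ext [where wt = gen_weight])
  show "homogeneous (gen_weight u + b) (lin_ext (star_word u) (coords g))" for u
  proof (subst add.commute, rule homogeneous_lin_ext [where wt = gen_weight])
    show "homogeneous (gen_weight v + gen_weight u) (star_word u v)" for v
      using homogeneous_star_word [of u v] by (simp add: add.commute)
  qed (rule coords_weight [OF assms(2,4)])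
qed (rule coords_weight [OF assms(1,3)])

section \<open>Closure under the shuffle product\<close>

lemma sh_add_left: "sh (f + f') g = sh f g + sh f' g"
  by (simp add: sh_def lin_ext_add)

lemma sh_add_right: "sh f (g + g') = sh f g + sh f g'"
  by (simp add: sh_def lin_ext_add lin_ext_fun_add)

lemma sh_cst_left: "sh (cst c * f) g = cst c * sh f g"
  by (simp add: sh_def lin_ext_cst_mult)

lemma sh_cst_right: "sh f (cst c * g) = cst c * sh f g"
  by (simp add: sh_def lin_ext_cst_mult lin_ext_fun_cst)

lemma sh_0_left: "sh 0 g = 0" and sh_0_right: "sh f 0 = 0"
  using sh_cst_left [of 0 0 g] sh_cst_right [of f 0 0] by simp_all

lemmas sh_linear = sh_0_left sh_0_right sh_add_left sh_add_right sh_cst_left sh_cst_right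

lemma sh_diff_left: "sh (f - f') g = sh f g - sh f' g"
  using sh_add_left [of "f - f'" f' g] by simp

lemma sh_diff_right: "sh f (g - g') = sh f g - sh f g'"
  using sh_add_right [of f "g - g'" g'] by simp

lemma sh_single: "sh (Poly_Mapping.single u 1) (Poly_Mapping.single v 1) = sh_word u v"
  by (simp add: sh_def lin_ext_single)

lemma sh_1_left: "sh 1 g = g"
proof (induction g rule: linear_induct)
  case (word v)
  show ?case using sh_single [of "[]" v] by simp
qed (simp_all add: sh_linear)

lemma sh_cst: "sh (cst c) g = cst c * g"
  using sh_cst_left [of c 1 g] by (simp add: sh_1_left)

lemma alpha_commute: "alpha u v = alpha v u"
  by (cases u; cases v) simp_all

lemma sh_word_Nil_right: "sh_word u [] = Poly_Mapping.single u 1"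
  by (cases u) simp_all

lemma sh_word_commute: "sh_word u v = sh_word v u"
  by (induction u v rule: sh_word.induct)
    (simp_all add: sh_word_Nil_right alpha_commute add_ac)

lemma sh_commute: "sh f g = sh g f"
proof (induction f rule: linear_induct)
  case (word u)
  show ?case
  proof (induction g rule: linear_induct)
    case (word v)
    show ?case by (simp add: sh_single sh_word_commute)
  qed (simp_all add: sh_linear)
qed (simp_all add: sh_linear)

text \<open>Both sides are bilinear in \<open>f\<close> and \<open>g\<close>, so the recursion for
  words passes to arbitrary tails; in this form it applies to products that begin with
  \<open>xi\<close>.\<close>

lemma sh_letters:
  "sh (letter_val u * f) (letter_val v * g) = letter_val u * sh f (letter_val v * g)
     + letter_val v * sh (letter_val u * f) g + alpha u v * sh f g"
proof (induction f rule: linear_induct)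
  case (word w)
  show ?case
  proof (induction g rule: linear_induct)
    case (word w')
    show ?case by (simp add: sh_single letter_val_single)
  qed (simp_all add: sh_linear distrib_left cst_left_commute)
qed (simp_all add: sh_linear distrib_left cst_left_commute)

text \<open>The letter \<open>rho\<close> acts like multiplication by a scalar function.\<close>

lemma sh_word_rho: "sh_word (LRho # u) v = rho * sh_word u v"
proof (induction v)
  case Nil
  show ?case by (simp add: sh_word_Nil_right rho_def letter_val_single)
next
  case (Cons b v)
  have "alpha LRho b = - (letter_val b * rho)" by (cases b) (simp_all add: rho_def)
  \<comment> \<open>By the induction hypothesis the summand starting with \<open>b\<close> equals
    \<open>letter_val b * rho * sh_word u v\<close>, which the \<open>alpha\<close> term
    cancels.\<close>
  with Cons show ?case by (simp add: mult.assoc rho_def)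
qed

lemma sh_rho_left: "sh (rho * f) g = rho * sh f g"
proof (induction f rule: linear_induct)
  case (word u)
  show ?case
  proof (induction g rule: linear_induct)
    case (word v)
    show ?case using sh_word_rho [of u v]
      by (simp add: sh_single letter_val_single rho_def flip: sh_single)
  qed (simp_all add: sh_linear distrib_left cst_left_commute)
qed (simp_all add: sh_linear distrib_left cst_left_commute)

lemma sh_rho_right: "sh f (rho * g) = rho * sh f g"
  using sh_rho_left [of g f] by (simp add: sh_commute [of f])

section \<open>Supports, and the letter words that span \<open>H1\<close>\<close>

definition words_in :: "('a list \<Rightarrow> bool) \<Rightarrow> ('a list \<Rightarrow>\<^sub>0 cring) set" where
  "words_in P = {f. \<forall>w\<in>Poly_Mapping.keys f. P w}"

lemma submodule_words_in: "submodule (words_in P)"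
proof -
  have "Poly_Mapping.keys (cst c * f) \<subseteq> Poly_Mapping.keys f" for c and f :: "'a list \<Rightarrow>\<^sub>0 cring"
  proof -
    have "Poly_Mapping.keys (cst c * f) \<subseteq>
        {u + v |u v. u \<in> Poly_Mapping.keys (cst c) \<and> v \<in> Poly_Mapping.keys f}"
      by (rule keys_mult)
    then show ?thesis by (auto simp: cst_def plus_list_def split: if_splits)
  qed
  then show ?thesis
    using keys_add by (fastforce simp: submodule_def words_in_def)
qed

lemma words_in_mult:
  assumes "f \<in> words_in P" "g \<in> words_in Q" "\<And>u v. P u \<Longrightarrow> Q v \<Longrightarrow> R (u @ v)"
  shows "f * g \<in> words_in R"
proof -
  have "Poly_Mapping.keys (f * g) \<subseteq>
      {u + v |u v. u \<in> Poly_Mapping.keys f \<and> v \<in> Poly_Mapping.keys g}"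
    by (rule keys_mult)
  with assms show ?thesis unfolding words_in_def plus_list_def by blast
qed

lemma words_in_single: "P w \<Longrightarrow> Poly_Mapping.single w c \<in> words_in P"
  by (simp add: words_in_def)

lemma words_in_letter:
  assumes "f \<in> words_in P" "\<And>w. P w \<Longrightarrow> Q (a # w)"
  shows "letter_val a * f \<in> words_in Q"
  unfolding letter_val_def
  by (rule words_in_mult [OF words_in_single [of "\<lambda>w. w = [a]"] assms(1)]) (use assms(2) in auto)

lemma words_in_mono: "f \<in> words_in P \<Longrightarrow> (\<And>w. P w \<Longrightarrow> Q w) \<Longrightarrow> f \<in> words_in Q"
  by (auto simp: words_in_def)

text \<open>The words spanning \<open>H1\<close>: every run of \<open>x\<close> is followed by \<open>y\<close>.\<close>

fun H1_word :: "letter list \<Rightarrow> bool" where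
  "H1_word [] = True"
| "H1_word (LX # w) = (H1_word w \<and> w \<noteq> [] \<and> hd w \<noteq> LRho)"
| "H1_word (_ # w) = H1_word w"

text \<open>Those words in front of which an \<open>x\<close> may be put span the sum of the \<open>z k * H1\<close>, \<open>k \<ge> 1\<close>.\<close>

abbreviation "zH1_word w \<equiv> H1_word (LX # w)"

lemma H1_word_append: "H1_word u \<Longrightarrow> H1_word v \<Longrightarrow> H1_word (u @ v)"
  by (induction u rule: H1_word.induct) auto

lemma zH1_word_run: "zH1_word (replicate k LX @ LY # v) \<longleftrightarrow> H1_word v"
  by (induction k) (auto simp: hd_append)

text \<open>The induction consumes the leading run of \<open>LX\<close>, which by
  \<open>H1_word\<close> can end neither at \<open>LRho\<close> nor with the word. This is what
  allows a leading generator \<open>z\<close> to be split off.\<close>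

lemma zH1_word_cases:
  assumes "zH1_word w"
  obtains k v where "w = replicate k LX @ LY # v" "H1_word v"
  using assms
proof (induction w arbitrary: thesis rule: H1_word.induct)
  case (2 w)
  show ?case
  proof (rule 2(1))
    fix k v assume "w = replicate k LX @ LY # v" "H1_word v"
    then show thesis by (intro 2(2) [of "Suc k" v]) simp_all
  qed (use 2(3) in simp)
next
  case ("3_1" w)
  show ?case using "3_1"(2) [of 0 w] "3_1"(3) by simp
qed auto

lemma z_Suc: "Defs.z (Suc k) = Poly_Mapping.single (replicate k LX @ [LY]) 1"
  by (simp add: Defs.z_def x_power Defs.y_def letter_val_def mult_single plus_list_def)

lemma submodule_H1: "submodule H1"
  by (auto simp: submodule_def intro: H1.intros) (metis H1_const cst_0)

lemma xi_in_H1: "xi \<in> H1" and z_in_H1: "k \<ge> 1 \<Longrightarrow> Defs.z k \<in> H1"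
  by (auto intro!: H1_gen simp: gen_set_def)

lemma y_eq_z: "Defs.y = Defs.z 1"
  by (simp add: Defs.z_def)

lemma rho_in_H1: "rho \<in> H1"
proof -
  have "Defs.z 1 - xi \<in> H1"
    by (intro submodule_diff submodule_H1 z_in_H1 xi_in_H1) simp
  then show ?thesis by (simp add: xi_def y_eq_z)
qed

text \<open>A leading run of x closed by y is a generator \<open>z\<close>, and a leading rho lies
  in \<open>H1\<close> as z 1 - xi. Either can be split off, whence the induction on the
  length.\<close>

lemma single_H1_word: "H1_word w \<Longrightarrow> Poly_Mapping.single w 1 \<in> H1"
proof (induction w rule: length_induct)
  case (1 w)
  show ?case
  proof (cases "zH1_word w")
    case True
    then obtain k v where w: "w = replicate k LX @ LY # v" "H1_word v" by (rule zH1_word_cases)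
    with 1 have "Poly_Mapping.single v 1 \<in> H1" by simp
    then have "Defs.z (Suc k) * Poly_Mapping.single v 1 \<in> H1"
      by (intro H1_mult z_in_H1) simp_all
    then show ?thesis by (simp add: z_Suc mult_single plus_list_def w)
  next
    case False
    show ?thesis
    proof (cases w)
      case Nil
      then show ?thesis using H1_const [of 1] by simp
    next
      case (Cons a v)
      with False 1(2) have "a = LRho" "H1_word v" by (cases a; auto)+
      with 1(1) Cons have "rho * Poly_Mapping.single v 1 \<in> H1"
        by (intro H1_mult rho_in_H1) simp
      then show ?thesis by (simp add: rho_def letter_val_single Cons \<open>a = LRho\<close>)
    qed
  qed
qed

lemma z_zH1_word: "Defs.z (Suc k) \<in> words_in zH1_word"
  unfolding z_Suc by (rule words_in_single) (simp only: zH1_word_run, simp)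

text \<open>Turns membership in \<open>H1\<close> into a condition on the support, the form in which
  the letterwise recursion of \<open>sh\<close> can be followed.\<close>

lemma H1_eq_words: "H1 = words_in H1_word"
proof
  have z: "Defs.z k \<in> words_in H1_word" if "k \<ge> 1" for k
    using words_in_mono [OF z_zH1_word [of "k - 1"], of H1_word] that by simp
  have "rho \<in> words_in H1_word"
    by (simp add: rho_def letter_val_def words_in_single)
  then have xi: "xi \<in> words_in H1_word"
    unfolding xi_def y_eq_z by (intro submodule_diff submodule_words_in z) simp
  have "f \<in> words_in H1_word" if "f \<in> H1" for f using that
  proof induction
    case (H1_const c)
    then show ?case by (simp add: cst_def words_in_single)
  next
    case (H1_gen a)
    then show ?case using xi z by (auto simp: gen_set_def)
  next
    case (H1_add f g)
    then show ?case by (intro submodule_add submodule_words_in)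
  next
    case (H1_mult f g)
    then show ?case using words_in_mult H1_word_append by blast
  qed
  then show "H1 \<subseteq> words_in H1_word" by auto
  have "f \<in> H1" if "f \<in> words_in H1_word" for f
    by (induction f rule: linear_induct)
      (use that in \<open>auto intro: submodule_0 submodule_add submodule_cst submodule_H1
         single_H1_word simp: words_in_def\<close>)
  then show "words_in H1_word \<subseteq> H1" by auto
qed

definition zH1 :: "halg set" where
  "zH1 = words_in zH1_word"

lemma submodule_zH1: "submodule zH1"
  by (simp add: zH1_def submodule_words_in)

lemma zH1_subset_H1: "f \<in> zH1 \<Longrightarrow> f \<in> H1"
  unfolding zH1_def H1_eq_words by (erule words_in_mono) simp

lemma y_mult_zH1: "f \<in> H1 \<Longrightarrow> Defs.y * f \<in> zH1"
  unfolding zH1_def H1_eq_words Defs.y_def by (erule words_in_letter) simp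

lemma x_mult_zH1: "f \<in> zH1 \<Longrightarrow> Defs.x * f \<in> zH1"
  unfolding zH1_def Defs.x_def by (erule words_in_letter) simp

lemma z_mult_zH1: "f \<in> H1 \<Longrightarrow> Defs.z (Suc k) * f \<in> zH1"
  unfolding zH1_def H1_eq_words
  by (rule words_in_mult [OF z_zH1_word, where Q = H1_word])
    (auto simp: H1_word_append hd_append)

text \<open>The second claim has to be carried along, because behind a leading x the recursion needs
  a product that may follow x. A leading rho is pulled out of the product; if both words start with
  x or y, every nonzero summand starts with x or y and lands in \<open>zH1\<close>.\<close>

lemma sh_word_closed:
  assumes "H1_word u" "H1_word v"
  shows "sh_word u v \<in> H1 \<and> (zH1_word u \<longrightarrow> zH1_word v \<longrightarrow> sh_word u v \<in> zH1)"
  using assms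
proof (induction u v rule: sh_word.induct)
  case (1 w)
  then show ?case by (auto intro: single_H1_word)
next
  case (2 a w)
  then show ?case by (auto intro: single_H1_word)
next
  case (3 u w v w')
  have rho: "rho * sh_word s t \<in> H1" if "sh_word s t \<in> H1" for s t
    using that by (intro H1_mult rho_in_H1)
  consider "u = LRho" | "u \<noteq> LRho" "v = LRho" | "u \<noteq> LRho" "v \<noteq> LRho" by blast
  then show ?case
  proof cases
    case 1
    then show ?thesis using 3 rho [of w "v # w'"] by (simp only: sh_word_rho) simp
  next
    case 2
    then have "sh_word (u # w) (v # w') = rho * sh_word (u # w) w'"
      by (metis sh_word_commute sh_word_rho)
    then show ?thesis using 2 3 rho [of "u # w" w'] by (simp del: sh_word.simps)
  next
    case uv: 3
    have a: "letter_val u * sh_word w (v # w') \<in> zH1"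
    proof (cases u)
      case LX
      then have "sh_word w (v # w') \<in> zH1" using uv 3 by (simp del: sh_word.simps)
      then show ?thesis using LX x_mult_zH1 by (simp add: Defs.x_def)
    next
      case LY
      then have "sh_word w (v # w') \<in> H1" using uv 3 by (simp del: sh_word.simps)
      then show ?thesis using LY y_mult_zH1 by (simp add: Defs.y_def)
    qed (use uv in simp)
    have b: "letter_val v * sh_word (u # w) w' \<in> zH1"
    proof (cases v)
      case LX
      then have "sh_word (u # w) w' \<in> zH1" using uv 3 by (simp del: sh_word.simps)
      then show ?thesis using LX x_mult_zH1 by (simp add: Defs.x_def)
    next
      case LY
      then have "sh_word (u # w) w' \<in> H1" using uv 3 by (simp del: sh_word.simps)
      then show ?thesis using LY y_mult_zH1 by (simp add: Defs.y_def)
    qed (use uv in simp)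
    have c: "alpha u v * sh_word w w' \<in> zH1"
    proof (cases u; cases v)
      assume "u = LX" "v = LX"
      then show ?thesis using 3
        by (auto simp: mult.assoc hbar_def intro!: submodule_cst submodule_zH1 x_mult_zH1)
    next
      assume "u = LY" "v = LY"
      then have "rho * sh_word w w' \<in> H1" using 3 rho by simp
      from submodule_uminus [OF submodule_zH1 y_mult_zH1 [OF this]] show ?thesis
        using \<open>u = LY\<close> \<open>v = LY\<close> by (simp add: mult.assoc)
    qed (use uv submodule_0 [OF submodule_zH1] in auto)
    show ?thesis using a b c
      by (auto intro!: submodule_add submodule_zH1 zH1_subset_H1)
  qed
qed

lemma sh_closed:
  assumes "submodule K" "f \<in> words_in P" "g \<in> words_in Q"
    and "\<And>u v. P u \<Longrightarrow> Q v \<Longrightarrow> sh_word u v \<in> K"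
  shows "sh f g \<in> K"
  unfolding sh_def using assms(2-)
  by (intro submodule_lin_ext assms(1)) (auto simp: words_in_def)

lemma sh_H1: "f \<in> H1 \<Longrightarrow> g \<in> H1 \<Longrightarrow> sh f g \<in> H1"
  by (rule sh_closed [OF submodule_H1, where P = H1_word and Q = H1_word])
    (simp_all add: sh_word_closed flip: H1_eq_words)

lemma sh_zH1: "f \<in> zH1 \<Longrightarrow> g \<in> zH1 \<Longrightarrow> sh f g \<in> zH1"
  by (rule sh_closed [OF submodule_zH1, where P = zH1_word and Q = zH1_word])
    (use sh_word_closed in \<open>auto simp: zH1_def\<close>)

section \<open>The module \<open>H0hat\<close> and its decomposition by leading factors\<close>

lemma H0hatI: "u \<in> H1 \<Longrightarrow> (\<And>k. v k \<in> H1) \<Longrightarrow>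
    cst c + xi * u + (\<Sum>k=2..m. Defs.z k * v k) \<in> H0hat"
  unfolding H0hat_def by blast

lemma zero_in_H1: "0 \<in> H1"
  using submodule_0 [OF submodule_H1] .

lemma submodule_H0hat: "submodule H0hat"
  unfolding submodule_def
proof (intro conjI ballI allI)
  show "0 \<in> H0hat" using H0hatI [of 0 "\<lambda>_. 0" 0 0] by (simp add: zero_in_H1)
next
  fix f g assume "f \<in> H0hat" "g \<in> H0hat"
  then obtain c u v m c' u' v' m' where
    f: "f = cst c + xi * u + (\<Sum>k=2..m. Defs.z k * v k)" "u \<in> H1" "\<And>k. v k \<in> H1" and
    g: "g = cst c' + xi * u' + (\<Sum>k=2..m'. Defs.z k * v' k)" "u' \<in> H1" "\<And>k. v' k \<in> H1"
    unfolding H0hat_def by blast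
  define n where "n = max m m'"
  have *: "(\<Sum>k=2..l. Defs.z k * w k) = (\<Sum>k=2..n. Defs.z k * (if k \<le> l then w k else 0))"
    if "l \<le> n" for l w
    by (rule sum.mono_neutral_cong_left) (use that in auto)
  have "f + g = cst (c + c') + xi * (u + u') + (\<Sum>k=2..n. Defs.z k *
      ((if k \<le> m then v k else 0) + (if k \<le> m' then v' k else 0)))"
    unfolding f(1) g(1) *[of m v, OF max.cobounded1 [of m m', folded n_def]]
      *[of m' v', OF max.cobounded2 [of m' m, folded n_def]]
    by (simp only: cst_add distrib_left sum.distrib ac_simps)
  also have "\<dots> \<in> H0hat"
    by (rule H0hatI) (use f g zero_in_H1 in \<open>auto intro: H1_add\<close>)
  finally show "f + g \<in> H0hat" .
next
  fix c f assume "f \<in> H0hat"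
  then obtain e u v m where
    f: "f = cst e + xi * u + (\<Sum>k=2..m. Defs.z k * v k)" "u \<in> H1" "\<And>k. v k \<in> H1"
    unfolding H0hat_def by blast
  have "cst c * f = cst (c * e) + xi * (cst c * u) + (\<Sum>k=2..m. Defs.z k * (cst c * v k))"
    unfolding f(1) distrib_left cst_mult sum_distrib_left
    by (simp only: cst_left_commute [of xi] cst_left_commute [of "Defs.z _"])
  also have "\<dots> \<in> H0hat"
    by (rule H0hatI) (use f in \<open>auto intro: H1_mult H1_const\<close>)
  finally show "cst c * f \<in> H0hat" .
qed

lemma cst_in_H0hat: "cst c \<in> H0hat"
  using H0hatI [of 0 "\<lambda>_. 0" c 0] by (simp add: zero_in_H1)

lemma xi_mult_H0hat: "u \<in> H1 \<Longrightarrow> xi * u \<in> H0hat"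
  using H0hatI [of u "\<lambda>_. 0" 0 0] by (simp add: zero_in_H1)

lemma z_mult_H0hat:
  assumes "k \<ge> 2" "v \<in> H1" shows "Defs.z k * v \<in> H0hat"
proof -
  have "Defs.z k * v = (\<Sum>i=2..k. Defs.z i * (if i = k then v else 0))"
    using assms by (subst sum.mono_neutral_right [of _ "{k}"]) auto
  then show ?thesis
    using H0hatI [of 0 "\<lambda>i. if i = k then v else 0" 0 k] assms(2) zero_in_H1 by auto
qed

lemma x_z: "Defs.x * Defs.z (Suc k) = Defs.z (Suc (Suc k))"
  by (simp add: Defs.z_def mult.assoc)

text \<open>Prefixing x raises the index of the leading generator \<open>z\<close> by one, hence to
  at least 2.\<close>

lemma x_mult_H0hat:
  assumes "j \<in> zH1" shows "Defs.x * j \<in> H0hat"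
proof (induction j rule: linear_induct)
  case (word w)
  with assms have "zH1_word w" by (auto simp: zH1_def words_in_def)
  then obtain k v where w: "w = replicate k LX @ LY # v" "H1_word v" by (rule zH1_word_cases)
  have "Poly_Mapping.single w 1 = Defs.z (Suc k) * Poly_Mapping.single v 1"
    by (simp add: z_Suc mult_single plus_list_def w)
  then have "Defs.x * Poly_Mapping.single w 1
      = Defs.z (Suc (Suc k)) * Poly_Mapping.single v 1"
    by (simp only: mult.assoc [symmetric] x_z)
  then show ?case using single_H1_word [OF w(2)] by (simp add: z_mult_H0hat)
qed (auto simp: distrib_left cst_left_commute
      intro: submodule_0 submodule_add submodule_cst submodule_H0hat)

text \<open>The summands with z k for k >= 2 share a leading x. This brings an element of
  \<open>H0hat\<close> into a shape to which the letter recursion of \<open>sh\<close>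
  applies.\<close>

lemma H0hat_cases:
  assumes "f \<in> H0hat"
  obtains c u j where "f = cst c + xi * u + Defs.x * j" "u \<in> H1" "j \<in> zH1"
proof -
  obtain c u v m where
    f: "f = cst c + xi * u + (\<Sum>k=2..m. Defs.z k * v k)" "u \<in> H1" "\<And>k. v k \<in> H1"
    using assms unfolding H0hat_def by blast
  have z: "Defs.z k = Defs.x * Defs.z (Suc (k - 2))" if "k \<in> {2..m}" for k
  proof -
    have "Suc (Suc (k - 2)) = k" using that by auto
    then show ?thesis using x_z [of "k - 2"] by simp
  qed
  have "(\<Sum>k=2..m. Defs.z k * v k) = Defs.x * (\<Sum>k=2..m. Defs.z (Suc (k - 2)) * v k)"
      (is "?S = Defs.x * ?j")
    unfolding sum_distrib_left by (rule sum.cong) (auto simp: z mult.assoc simp del: One_nat_def)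
  then have "f = cst c + xi * u + Defs.x * ?j" by (simp only: f(1))
  moreover have "?j \<in> zH1"
    by (intro submodule_sum submodule_zH1 z_mult_zH1 f)
  ultimately show thesis using that f(2) by blast
qed

lemma H0hat_subset_H1: "f \<in> H0hat \<Longrightarrow> f \<in> H1"
  by (elim H0hat_cases, simp only:)
    (intro H1_add H1_const H1_mult [OF xi_in_H1] zH1_subset_H1 [OF x_mult_zH1])

text \<open>With xi = y - rho, the recursion treats the part with y (the correction for y and x is
  0) and rho is pulled out in front. The two parts recombine to a leading xi, so no summand keeps a
  bare leading y, which would leave \<open>H0hat\<close>.\<close>

lemma sh_xi_x:
  "sh (xi * u) (Defs.x * j) = xi * sh u (Defs.x * j) + Defs.x * sh (Defs.y * u) j"
  using sh_letters [of LY u LX j]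
  by (simp add: xi_def left_diff_distrib sh_diff_left sh_rho_left
      flip: Defs.x_def Defs.y_def)

text \<open>The correction - y rho for two letters y combines with the rho rho from the two
  pulled-out factors to - xi rho, so that again every summand starts with xi.\<close>

lemma sh_xi_xi:
  "sh (xi * u) (xi * v) = xi * sh u (Defs.y * v) + xi * sh (Defs.y * u) v - xi * (rho * sh u v)"
  using sh_letters [of LY u LY v]
  by (simp add: xi_def left_diff_distrib right_diff_distrib sh_diff_left sh_diff_right
      sh_rho_left sh_rho_right mult.assoc flip: Defs.y_def)

lemma sh_x_x:
  "sh (Defs.x * u) (Defs.x * v)
     = Defs.x * (sh u (Defs.x * v) + sh (Defs.x * u) v + hbar * sh u v)"
  using sh_letters [of LX u LX v]
  by (simp add: distrib_left hbar_left_commute mult.assoc flip: Defs.x_def)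

lemma sh_H0hat:
  assumes "f \<in> H0hat" "g \<in> H0hat"
  shows "sh f g \<in> H0hat"
proof -
  obtain c u j where f: "f = cst c + xi * u + Defs.x * j" "u \<in> H1" "j \<in> zH1"
    using assms(1) by (rule H0hat_cases)
  obtain e v i where g: "g = cst e + xi * v + Defs.x * i" "v \<in> H1" "i \<in> zH1"
    using assms(2) by (rule H0hat_cases)
  note y = y_mult_zH1 [THEN zH1_subset_H1]
  have xi_x: "sh (xi * a) (Defs.x * b) \<in> H0hat" if "a \<in> H1" "b \<in> zH1" for a b
    unfolding sh_xi_x using that
    by (intro submodule_add submodule_H0hat xi_mult_H0hat x_mult_H0hat sh_H1 sh_zH1
        y_mult_zH1 zH1_subset_H1 [OF x_mult_zH1])
  have xi_xi: "sh (xi * u) (xi * v) \<in> H0hat"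
    unfolding sh_xi_xi using f g
    by (intro submodule_add submodule_diff submodule_H0hat xi_mult_H0hat sh_H1 y
        H1_mult [OF rho_in_H1])
  have x_x: "sh (Defs.x * j) (Defs.x * i) \<in> H0hat"
    unfolding sh_x_x hbar_def using f g
    by (intro x_mult_H0hat submodule_add submodule_cst submodule_zH1 sh_zH1 x_mult_zH1)
  have tail: "xi * u + Defs.x * j \<in> H0hat"
    using f by (intro submodule_add submodule_H0hat xi_mult_H0hat x_mult_H0hat)
  \<comment> \<open>\<open>cst c * g\<close> already contains the product of the two constants, so
    \<open>cst e\<close> is paired only with the nonconstant part of \<open>f\<close>.\<close>
  have "sh f g = cst c * g + cst e * (xi * u + Defs.x * j) + sh (xi * u) (xi * v)
      + sh (xi * u) (Defs.x * i) + sh (xi * v) (Defs.x * j) + sh (Defs.x * j) (Defs.x * i)"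
    unfolding f(1) sh_add_left sh_cst
    unfolding g(1) sh_add_right sh_commute [of _ "cst e"] sh_cst
      sh_commute [of "Defs.x * j" "xi * v"]
    by (simp add: algebra_simps)
  then show ?thesis
    using xi_x [OF f(2) g(3)] xi_x [OF g(2) f(3)] xi_xi x_x tail assms(2)
    by (auto intro!: submodule_add submodule_cst submodule_H0hat)
qed

section \<open>Closure under the harmonic product\<close>

lemma gen_val_in_H1: "gen_val a \<in> H1"
  by (cases a) (auto intro: xi_in_H1 z_in_H1)

lemma gen_word_in_H1: "gen_word w \<in> H1"
  using rangeI [of "lin_ext gen_word" "Poly_Mapping.single w 1"]
  by (simp add: range_gen_word lin_ext_single)

lemma hbar_mult: "submodule K \<Longrightarrow> f \<in> K \<Longrightarrow> hbar * f \<in> K"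
  by (simp add: hbar_def submodule_cst)

lemma circ_in_H1: "circ a b \<in> H1"
  by (cases a; cases b) (auto intro!: H1_add submodule_diff hbar_mult submodule_H1 xi_in_H1 z_in_H1)

lemma star_word_in_H1: "star_word u v \<in> H1"
  by (induction u v rule: star_word.induct)
    (auto intro!: gen_word_in_H1 H1_add H1_mult gen_val_in_H1 circ_in_H1)

text \<open>\<open>GZ 0\<close> names z 1, the only generator that may not begin a word of
  \<open>H0hat\<close>.\<close>

abbreviation adm_word :: "gen list \<Rightarrow> bool" where
  "adm_word w \<equiv> w = [] \<or> hd w \<noteq> GZ 0"

lemma gen_val_mult_H0hat: "a \<noteq> GZ 0 \<Longrightarrow> f \<in> H1 \<Longrightarrow> gen_val a * f \<in> H0hat"
  by (cases a) (auto intro: xi_mult_H0hat z_mult_H0hat)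

text \<open>All indices of \<open>z\<close> stay at least 2: for two factors z of index at least 2
  even the lower term of \<open>circ\<close> has index at least 3, and xi with xi yields z 2 and
  xi.\<close>

lemma circ_mult_H0hat:
  "a \<noteq> GZ 0 \<Longrightarrow> b \<noteq> GZ 0 \<Longrightarrow> f \<in> H1 \<Longrightarrow> circ a b * f \<in> H0hat"
  by (cases a; cases b)
    (auto simp: distrib_right left_diff_distrib mult.assoc intro!: submodule_add submodule_diff
      hbar_mult submodule_H0hat z_mult_H0hat xi_mult_H0hat)

lemma gen_word_in_H0hat: "adm_word w \<Longrightarrow> gen_word w \<in> H0hat"
  by (cases w) (use cst_in_H0hat [of 1] gen_word_in_H1 gen_val_mult_H0hat in \<open>auto simp: gen_word_def\<close>)

lemma star_word_in_H0hat: "adm_word u \<Longrightarrow> adm_word v \<Longrightarrow> star_word u v \<in> H0hat"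
proof (cases "(u, v)" rule: star_word.cases)
  case (3 a u' b v')
  moreover assume "adm_word u" "adm_word v"
  ultimately show ?thesis
    by (auto intro!: submodule_add submodule_H0hat gen_val_mult_H0hat circ_mult_H0hat star_word_in_H1
        simp del: circ.simps gen_val.simps)
qed (auto intro: gen_word_in_H0hat simp del: disj_not1)

text \<open>\<open>coords\<close> is only given as an inverse function. A preimage \<open>F\<close>
  with admissible words is therefore written down, and injectivity of
  \<open>lin_ext gen_word\<close> identifies it with \<open>coords f\<close>.\<close>

lemma coords_H0hat:
  assumes "f \<in> H0hat" shows "coords f \<in> words_in adm_word"
proof -
  obtain c u v m where
    f: "f = cst c + xi * u + (\<Sum>k=2..m. Defs.z k * v k)" "u \<in> H1" "\<And>k. v k \<in> H1"
    using assms unfolding H0hat_def by blast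
  define F where "F = cst c + Poly_Mapping.single [GXi] 1 * coords u
    + (\<Sum>k=2..m. Poly_Mapping.single [GZ (k - 1)] 1 * coords (v k))"
  have single: "Poly_Mapping.single [a] 1 * g \<in> words_in adm_word" if "a \<noteq> GZ 0" for a g
    by (rule words_in_mult [OF words_in_single [of "\<lambda>w. w = [a]"], where Q = "\<lambda>_. True"])
      (use that in \<open>auto simp: words_in_def\<close>)
  have "F \<in> words_in adm_word" unfolding F_def
    by (intro submodule_add submodule_sum submodule_words_in single)
      (auto simp: cst_def words_in_single)
  moreover have "lin_ext gen_word F = f"
  proof -
    have gen: "lin_ext gen_word (Poly_Mapping.single [a] 1 * coords g) = gen_val a * g"
      if "g \<in> H1" for a g
      using lin_ext_coords [OF that] lin_ext_single [of gen_word "[a]" 1]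
      by (simp add: lin_ext_gen_word subst_alg_mult gen_word_def)
    have sum: "lin_ext gen_word (\<Sum>k\<in>I. G k) = (\<Sum>k\<in>I. lin_ext gen_word (G k))" for I and G :: "nat \<Rightarrow> _"
      by (induction I rule: infinite_finite_induct) (auto simp: lin_ext_add)
    have "lin_ext gen_word (cst c) = cst c"
      unfolding cst_def [of c, where 'a = gen] lin_ext_single by (simp add: gen_word_def)
    moreover have "(\<Sum>k=2..m. gen_val (GZ (k - 1)) * v k) = (\<Sum>k=2..m. Defs.z k * v k)"
      by (rule sum.cong) auto
    ultimately show ?thesis
      unfolding F_def lin_ext_add sum by (simp add: gen f)
  qed
  ultimately show ?thesis by (metis coords_lin_ext)
qed

lemma star_closed:
  assumes "submodule K" "coords f \<in> words_in P" "coords g \<in> words_in P"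
    and "\<And>u v. P u \<Longrightarrow> P v \<Longrightarrow> star_word u v \<in> K"
  shows "star f g \<in> K"
  unfolding star_def using assms(2-)
  by (intro submodule_lin_ext assms(1)) (auto simp: words_in_def)

lemma star_H0hat: "f \<in> H0hat \<Longrightarrow> g \<in> H0hat \<Longrightarrow> star f g \<in> H0hat"
  by (rule star_closed [OF submodule_H0hat coords_H0hat coords_H0hat star_word_in_H0hat])

section \<open>Generating series\<close>

definition multiplier :: "(nat \<Rightarrow> complex) \<Rightarrow> complex fps \<Rightarrow> complex fps" where
  "multiplier a F = Abs_fps (\<lambda>n. a n * fps_nth F n)"

lemma multiplier_nth [simp]: "fps_nth (multiplier a F) n = a n * fps_nth F n"
  by (simp add: multiplier_def)

text \<open>An integration by parts: \<open>c\<close>, \<open>d\<close>, \<open>e\<close> are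
  evaluated at the total degree m + n only, so after convolution they act as multipliers on whole
  products. The coefficient identity is assumed for positive degrees, whence the condition on
  constant terms.\<close>

lemma multiplier_mult:
  assumes "fps_nth F 0 = 0" "fps_nth G 0 = 0"
    and "\<And>m n. m > 0 \<Longrightarrow> n > 0 \<Longrightarrow> a m * b n = c (m + n) * b n + d (m + n) * a m + e (m + n)"
  shows "multiplier a F * multiplier b G =
    multiplier c (F * multiplier b G) + multiplier d (multiplier a F * G) + multiplier e (F * G)"
proof (rule fps_ext)
  fix n
  have "a i * fps_nth F i * (b (n - i) * fps_nth G (n - i)) =
      c n * (fps_nth F i * (b (n - i) * fps_nth G (n - i)))
      + d n * (a i * fps_nth F i * fps_nth G (n - i))
      + e n * (fps_nth F i * fps_nth G (n - i))" if "i \<in> {0..n}" for i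
  proof (cases "i = 0 \<or> n - i = 0")
    case False
    then have "a i * b (n - i) = c n * b (n - i) + d n * a i + e n"
      using assms(3) [of i "n - i"] that by simp
    then have "(a i * b (n - i)) * (fps_nth F i * fps_nth G (n - i))
      = (c n * b (n - i) + d n * a i + e n) * (fps_nth F i * fps_nth G (n - i))" by simp
    then show ?thesis by (simp add: algebra_simps)
  qed (use assms(1,2) in auto)
  then show "fps_nth (multiplier a F * multiplier b G) n =
    fps_nth (multiplier c (F * multiplier b G) + multiplier d (multiplier a F * G)
      + multiplier e (F * G)) n"
    by (simp add: fps_mult_nth sum_distrib_left flip: sum.distrib)
qed

text \<open>The series t/(1-t). Its missing constant term makes the partial sums below strict, and
  this produces the condition n_1 > n_2 > ... of the multiple sums.\<close>

definition ones :: "complex fps" where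
  "ones = Abs_fps (\<lambda>n. if n = 0 then 0 else 1)"

lemma ones_mult_nth: "fps_nth (ones * F) n = (\<Sum>m<n. fps_nth F m)"
proof -
  have "fps_nth (F * ones) n = (\<Sum>m<n. fps_nth F m)"
    unfolding fps_mult_nth ones_def by (rule sum.mono_neutral_cong_right) auto
  then show ?thesis by (simp add: mult.commute)
qed

text \<open>For |q| < 1 the multiplier of \<open>LX\<close> is the sum of (1-q) q^(j n) over j >= 1,
  and that of \<open>LY\<close> the same sum over j >= 0. In degree 0 the denominator vanishes, and
  since division by 0 gives 0 the constant term is dropped.\<close>

fun letter_op :: "complex \<Rightarrow> letter \<Rightarrow> complex fps \<Rightarrow> complex fps" where
  "letter_op q LX F = multiplier (\<lambda>n. q ^ n / qnum q n) F"
| "letter_op q LY F = multiplier (\<lambda>n. 1 / qnum q n) (ones * F)"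
| "letter_op q LRho F = fps_const (1 - q) * (ones * F)"

lemma letter_op_add: "letter_op q a (F + G) = letter_op q a F + letter_op q a G"
  by (cases a) (auto simp: distrib_left intro!: fps_ext)

lemma letter_op_const: "letter_op q a (fps_const c * F) = fps_const c * letter_op q a F"
  by (cases a) (auto simp: mult.left_commute [of _ "fps_const c"] intro!: fps_ext)

lemma letter_op_nth_0: "fps_nth (letter_op q a F) 0 = 0"
  by (cases a) (simp_all add: ones_mult_nth qnum_def del: fps_mult_nth_0)

definition word_series :: "complex \<Rightarrow> letter list \<Rightarrow> complex fps" where
  "word_series q w = foldr (letter_op q) w 1"

lemma word_series_simps [simp]:
  "word_series q [] = 1" "word_series q (a # w) = letter_op q a (word_series q w)"
  by (simp_all add: word_series_def)

section \<open>Evaluation at hbar = 1 - q and the series of an algebra element\<close>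

lemma map_poly_of_rat_add:
  "map_poly of_rat (p + r) = map_poly of_rat p + (map_poly of_rat r :: complex poly)"
  by (rule poly_eqI) (simp add: coeff_map_poly of_rat_add)

lemma map_poly_of_rat_mult:
  "map_poly of_rat (p * r) = map_poly of_rat p * (map_poly of_rat r :: complex poly)"
  by (rule poly_eqI) (simp add: coeff_map_poly coeff_mult of_rat_sum of_rat_mult)

lemma ceval_add: "ceval q (a + b) = ceval q a + ceval q b"
  by (simp add: ceval_def map_poly_of_rat_add)

lemma ceval_mult: "ceval q (a * b) = ceval q a * ceval q b"
  by (simp add: ceval_def map_poly_of_rat_mult)

lemma ceval_0 [simp]: "ceval q 0 = 0" and ceval_1 [simp]: "ceval q 1 = 1"
  by (simp_all add: ceval_def)

lemma ceval_hbar: "ceval q [:0, 1:] = 1 - q"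
  by (simp add: ceval_def map_poly_pCons)

definition gser :: "complex \<Rightarrow> halg \<Rightarrow> complex fps" where
  "gser q f = (\<Sum>w\<in>Poly_Mapping.keys f.
     fps_const (ceval q (Poly_Mapping.lookup f w)) * word_series q w)"

lemma gser_superset:
  assumes "finite W" "Poly_Mapping.keys f \<subseteq> W"
  shows "gser q f = (\<Sum>w\<in>W. fps_const (ceval q (Poly_Mapping.lookup f w)) * word_series q w)"
  unfolding gser_def
  by (rule sum.mono_neutral_left) (use assms in \<open>auto simp: in_keys_iff\<close>)

lemma gser_0 [simp]: "gser q 0 = 0"
  by (simp add: gser_def)

lemma gser_add: "gser q (f + g) = gser q f + gser q g"
proof -
  let ?W = "Poly_Mapping.keys f \<union> Poly_Mapping.keys g"
  have "Poly_Mapping.keys (f + g) \<subseteq> ?W" by (rule keys_add)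
  then show ?thesis
    by (simp add: gser_superset [of ?W] lookup_add ceval_add distrib_right sum.distrib
        flip: fps_const_add)
qed

lemma gser_single:
  "gser q (Poly_Mapping.single w c) = fps_const (ceval q c) * word_series q w"
  by (subst gser_superset [of "{w}"]) (auto simp: lookup_single when_def split: if_splits)

lemma gser_cst: "gser q (cst c * f) = fps_const (ceval q c) * gser q f"
proof (induction f rule: pm_induct)
  case (single w e)
  show ?case by (simp add: cst_single gser_single ceval_mult mult.assoc flip: fps_const_mult)
qed (simp_all add: distrib_left gser_add)

lemma gser_hbar: "gser q (hbar * f) = fps_const (1 - q) * gser q f"
  by (simp add: hbar_def gser_cst ceval_hbar)

lemma gser_uminus: "gser q (- f) = - gser q f"
  using gser_add [of q f "- f"] by (simp add: eq_neg_iff_add_eq_0 add.commute)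

lemma gser_diff: "gser q (f - g) = gser q f - gser q g"
  using gser_add [of q f "- g"] by (simp add: gser_uminus)

lemma gser_sum: "gser q (\<Sum>i\<in>I. f i) = (\<Sum>i\<in>I. gser q (f i))"
  by (induction I rule: infinite_finite_induct) (simp_all add: gser_add)

lemma gser_lin_ext: "gser q (lin_ext F f) =
    (\<Sum>w\<in>Poly_Mapping.keys f. fps_const (ceval q (Poly_Mapping.lookup f w)) * gser q (F w))"
  by (simp add: lin_ext_def gser_sum gser_cst)

lemma gser_letter: "gser q (letter_val a * f) = letter_op q a (gser q f)"
proof (induction f rule: linear_induct)
  case zero
  show ?case using letter_op_const [of q a 0 0] by simp
next
  case (word w)
  show ?case by (simp add: letter_val_single gser_single)
qed (simp_all add: distrib_left cst_left_commute gser_add gser_cst letter_op_add letter_op_const)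

lemmas gser_x = gser_letter [of _ LX, folded Defs.x_def]
lemmas gser_y = gser_letter [of _ LY, folded Defs.y_def]
lemmas gser_rho = gser_letter [of _ LRho, folded rho_def]

text \<open>On \<open>H1\<close> this truncates the multiple sums at n_1 <= N; the term of degree 0
  is the contribution of the empty word.\<close>

definition psum :: "complex \<Rightarrow> nat \<Rightarrow> halg \<Rightarrow> complex" where
  "psum q N f = (\<Sum>n\<le>N. fps_nth (gser q f) n)"

section \<open>Product rules for the letter operators, and the series of a shuffle product\<close>

context
  fixes q :: complex
  assumes q_pos: "0 < cmod q" and q_less: "cmod q < 1"
begin

lemma q_ne_1: "1 - q \<noteq> 0"
  using q_less by auto

lemma q_power_ne_1: "n > 0 \<Longrightarrow> 1 - q ^ n \<noteq> 0"
  using power_less_one_iff [of "cmod q" n] q_less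
  by (metis eq_iff_diff_eq_0 less_irrefl norm_ge_zero norm_one norm_power)

lemma qnum_ne_0: "n > 0 \<Longrightarrow> qnum q n \<noteq> 0"
  using q_ne_1 q_power_ne_1 by (simp add: qnum_def)

lemma q_power_eq: "q ^ n = 1 - (1 - q) * qnum q n"
  using q_ne_1 by (simp add: qnum_def)

text \<open>Up to the factor (1-q)^2 the left side is the sum of q^(j m + k n) over j, k >= 1. The
  cases j < k, j > k and j = k give the three summands.\<close>

lemma coeff_x_x:
  assumes "m > 0" "n > 0"
  defines "a \<equiv> \<lambda>n. q ^ n / qnum q n"
  shows "a m * a n = a (m + n) * a n + a (m + n) * a m + (1 - q) * a (m + n)"
proof -
  have "1 - q ^ (m + n) \<noteq> 0" "1 - q ^ m \<noteq> 0" "1 - q ^ n \<noteq> 0" "1 - q \<noteq> 0"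
    using assms q_power_ne_1 q_ne_1 by auto
  then show ?thesis unfolding a_def qnum_def power_add by (simp add: divide_simps) algebra
qed

text \<open>Here j >= 1 and k >= 0. The cases j <= k and j > k cover each pair once, so there is no
  third summand.\<close>

lemma coeff_x_y:
  assumes "m > 0" "n > 0"
  defines "a \<equiv> \<lambda>n. q ^ n / qnum q n" and "b \<equiv> \<lambda>n. 1 / qnum q n"
  shows "a m * b n = a (m + n) * b n + b (m + n) * a m"
proof -
  have "1 - q ^ (m + n) \<noteq> 0" "1 - q ^ m \<noteq> 0" "1 - q ^ n \<noteq> 0" "1 - q \<noteq> 0"
    using assms q_power_ne_1 q_ne_1 by auto
  then show ?thesis unfolding a_def b_def qnum_def power_add by (simp add: divide_simps) algebra
qed

text \<open>Here j, k >= 0. The cases j <= k and k <= j both contain the diagonal, which is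
  subtracted once.\<close>

lemma coeff_y_y:
  assumes "m > 0" "n > 0"
  defines "b \<equiv> \<lambda>n. 1 / qnum q n"
  shows "b m * b n = b (m + n) * b n + b (m + n) * b m + - (1 - q) * b (m + n)"
proof -
  have "1 - q ^ (m + n) \<noteq> 0" "1 - q ^ m \<noteq> 0" "1 - q ^ n \<noteq> 0" "1 - q \<noteq> 0"
    using assms q_power_ne_1 q_ne_1 by auto
  then show ?thesis unfolding b_def qnum_def power_add by (simp add: divide_simps) algebra
qed

lemma multiplier_scale: "multiplier (\<lambda>n. c * a n) F = fps_const c * multiplier a F"
  by (rule fps_ext) simp

lemma letter_op_x_y:
  assumes "fps_nth F 0 = 0"
  shows "letter_op q LX F * letter_op q LY G =
    letter_op q LX (F * letter_op q LY G) + letter_op q LY (letter_op q LX F * G)"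
proof -
  have "multiplier (\<lambda>n. q ^ n / qnum q n) F * multiplier (\<lambda>n. 1 / qnum q n) (ones * G) =
      multiplier (\<lambda>n. q ^ n / qnum q n) (F * multiplier (\<lambda>n. 1 / qnum q n) (ones * G)) +
      multiplier (\<lambda>n. 1 / qnum q n) (multiplier (\<lambda>n. q ^ n / qnum q n) F * (ones * G)) +
      multiplier (\<lambda>_. 0) (F * (ones * G))"
    by (rule multiplier_mult, rule assms, simp only: ones_mult_nth lessThan_0 sum.empty,
        simp only: add_0_right, rule coeff_x_y)
  moreover have "multiplier (\<lambda>_. 0) H = 0" for H by (rule fps_ext) simp
  ultimately show ?thesis by (simp add: mult.left_commute)
qed

text \<open>\<open>h\<close> stands for the shuffle of the two tails, so that the correction can
  remain the algebra element \<open>alpha u v\<close>. If one letter is rho, its operator is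
  multiplication by a fixed series, and the \<open>alpha\<close> term cancels one of the other two
  summands.\<close>

lemma letter_op_mult:
  assumes "u = LX \<Longrightarrow> fps_nth F 0 = 0" "v = LX \<Longrightarrow> fps_nth G 0 = 0"
    and h: "gser q h = F * G"
  shows "letter_op q u F * letter_op q v G =
    letter_op q u (F * letter_op q v G) + letter_op q v (letter_op q u F * G)
    + gser q (alpha u v * h)"
proof -
  have rho: "gser q (- (letter_val a * rho) * h)
      = - letter_op q a (fps_const (1 - q) * (ones * (F * G)))" for a
    by (simp add: gser_uminus gser_letter gser_rho mult.assoc h)
  have right: ?thesis if "v = LRho"
  proof -
    have "alpha u v = - (letter_val u * rho)" using that by (cases u) simp_all
    with that show ?thesis by (simp only: rho) (simp add: mult_ac)
  qed
  have left: ?thesis if "u = LRho"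
  proof -
    have "alpha u v = - (letter_val v * rho)" using that by (cases v) simp_all
    with that show ?thesis by (simp only: rho) (simp add: mult_ac)
  qed
  show ?thesis
  proof (cases u; cases v)
    assume uv: "u = LX" "v = LX"
    let ?a = "\<lambda>n. q ^ n / qnum q n"
    have "multiplier ?a F * multiplier ?a G = multiplier ?a (F * multiplier ?a G)
        + multiplier ?a (multiplier ?a F * G) + multiplier (\<lambda>n. (1 - q) * ?a n) (F * G)"
      by (intro multiplier_mult assms(1,2) uv coeff_x_x)
    moreover have "gser q (alpha u v * h) = fps_const (1 - q) * multiplier ?a (F * G)"
      using uv by (simp add: gser_hbar gser_x mult.assoc h)
    ultimately show ?thesis using uv by (simp only: multiplier_scale letter_op.simps)
  next
    assume uv: "u = LX" "v = LY"
    with letter_op_x_y [of F G] assms(1) show ?thesis by simp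
  next
    assume uv: "u = LY" "v = LX"
    with letter_op_x_y [of G F] assms(2) show ?thesis by (simp add: mult.commute add.commute)
  next
    assume uv: "u = LY" "v = LY"
    have "gser q (alpha u v * h)
        = multiplier (\<lambda>n. - (1 - q) * (1 / qnum q n)) ((ones * F) * (ones * G))"
    proof -
      have "gser q (alpha u v * h) = - letter_op q LY (fps_const (1 - q) * (ones * (F * G)))"
        using rho [of LY] uv by (simp add: Defs.y_def)
      also have "\<dots> = - (fps_const (1 - q) * letter_op q LY (ones * (F * G)))"
        by (simp only: letter_op_const)
      also have "\<dots> = fps_const (- (1 - q)) * letter_op q LY (ones * (F * G))"
        by (simp only: fps_const_neg [symmetric] mult_minus_left)
      finally show ?thesis by (simp only: multiplier_scale letter_op.simps mult_ac)
    qed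
    moreover have "multiplier (\<lambda>n. 1 / qnum q n) (ones * F) * multiplier (\<lambda>n. 1 / qnum q n) (ones * G) =
        multiplier (\<lambda>n. 1 / qnum q n) ((ones * F) * multiplier (\<lambda>n. 1 / qnum q n) (ones * G)) +
        multiplier (\<lambda>n. 1 / qnum q n) (multiplier (\<lambda>n. 1 / qnum q n) (ones * F) * (ones * G)) +
        multiplier (\<lambda>n. - (1 - q) * (1 / qnum q n)) ((ones * F) * (ones * G))"
      by (rule multiplier_mult, simp_all only: ones_mult_nth lessThan_0 sum.empty, rule coeff_y_y)
    ultimately show ?thesis
      using uv by (simp only: letter_op.simps mult_ac)
  qed (erule left | erule right)+
qed

lemma gser_sh_word:
  assumes "H1_word u" "H1_word v"
  shows "gser q (sh_word u v) = word_series q u * word_series q v"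
  using assms
proof (induction u v rule: sh_word.induct)
  case (3 u w v w')
  have tail: "H1_word (a # t) \<Longrightarrow> H1_word t" for a t by (cases a) simp_all
  note H1 = 3(4,5) [THEN tail]
  \<comment> \<open>This is where \<open>H1\<close> enters: x is never the last letter of such a
    word, so the series it acts on comes from a letter operator and has no constant term.\<close>
  have x: "fps_nth (word_series q t) 0 = 0" if "H1_word (LX # t)" for t
    using that by (cases t) (simp_all add: letter_op_nth_0)
  have "word_series q (u # w) * word_series q (v # w') =
    letter_op q u (word_series q w * word_series q (v # w')) +
    letter_op q v (word_series q (u # w) * word_series q w') +
    gser q (alpha u v * sh_word w w')"
    unfolding word_series_simps
    by (rule letter_op_mult) (use 3 H1 x in auto)
  then show ?case using 3 H1
    by (simp add: gser_add gser_letter del: word_series_simps)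
qed (simp_all add: gser_single)

lemma gser_sh:
  assumes "f \<in> H1" "g \<in> H1"
  shows "gser q (sh f g) = gser q f * gser q g"
proof -
  have words: "H1_word w" if "w \<in> Poly_Mapping.keys f \<union> Poly_Mapping.keys g" for w
    using assms that by (auto simp: H1_eq_words words_in_def)
  have "gser q (sh f g) = (\<Sum>u\<in>Poly_Mapping.keys f. \<Sum>v\<in>Poly_Mapping.keys g.
      (fps_const (ceval q (Poly_Mapping.lookup f u)) * word_series q u) *
      (fps_const (ceval q (Poly_Mapping.lookup g v)) * word_series q v))"
    unfolding sh_def gser_lin_ext sum_distrib_left
    by (intro sum.cong refl) (simp add: gser_sh_word words mult_ac)
  then show ?thesis by (simp add: gser_def sum_product)
qed

section \<open>Truncated sums and the harmonic product\<close>

text \<open>Each x only rescales the coefficient, and y contributes 1/[n] together with the strict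
  partial sum. For xi, the part with rho lowers 1/[n] by 1 - q, which leaves q^n/[n].\<close>

lemma gser_gen_val: "fps_nth (gser q (gen_val a * f)) n =
    (if n = 0 then 0 else Igen q a n * (\<Sum>m<n. fps_nth (gser q f) m))"
proof (cases "n = 0")
  case True
  have "fps_nth (gser q (Defs.x ^ k * (Defs.y * f))) 0 = 0" for k
    by (cases k) (simp_all add: mult.assoc gser_x gser_y qnum_def)
  then show ?thesis using True
    by (cases a) (simp_all add: xi_def left_diff_distrib gser_diff gser_y gser_rho ones_mult_nth
        Defs.z_def mult.assoc qnum_def del: fps_mult_nth_0)
next
  case False
  then have n: "qnum q n \<noteq> 0" using qnum_ne_0 by simp
  have x: "fps_nth (gser q (Defs.x ^ k * h)) n = (q ^ n / qnum q n) ^ k * fps_nth (gser q h) n"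
    for k h by (induction k) (simp_all add: mult.assoc gser_x)
  show ?thesis
  proof (cases a)
    case GXi
    have "1 / qnum q n - (1 - q) = q ^ n / qnum q n"
      using n by (simp add: field_simps q_power_eq)
    then have "(1 / qnum q n) * S - (1 - q) * S = q ^ n / qnum q n * S" for S
      by (simp only: left_diff_distrib [symmetric])
    then show ?thesis using False GXi
      by (simp add: xi_def left_diff_distrib gser_diff gser_y gser_rho ones_mult_nth)
  next
    case (GZ k)
    then show ?thesis using False
      by (simp add: Defs.z_def mult.assoc x gser_y ones_mult_nth power_divide mult.commute [of k]
          power_mult)
  qed
qed

lemma psum_add: "psum q N (f + g) = psum q N f + psum q N g"
  by (simp add: psum_def gser_add sum.distrib)

lemma psum_diff: "psum q N (f - g) = psum q N f - psum q N g"
  by (simp add: psum_def gser_diff sum_subtractf)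

lemma psum_hbar: "psum q N (hbar * f) = (1 - q) * psum q N f"
  by (simp add: psum_def gser_hbar sum_distrib_left)

lemma psum_lin_ext: "psum q N (lin_ext F f) =
    (\<Sum>w\<in>Poly_Mapping.keys f. ceval q (Poly_Mapping.lookup f w) * psum q N (F w))"
  by (simp add: psum_def gser_lin_ext fps_sum_nth sum_distrib_left sum.swap [of _ "{..N}"])

lemma psum_gen_val:
  "psum q 0 (gen_val a * f) = 0"
  "psum q (Suc N) (gen_val a * f) = psum q N (gen_val a * f) + Igen q a (Suc N) * psum q N f"
  by (simp_all add: psum_def gser_gen_val lessThan_Suc_atMost)

lemma circ_gen_val:
  "circ (GZ k) (GZ l) = gen_val (GZ (Suc (k + l))) + hbar * gen_val (GZ (k + l))"
  "circ GXi (GZ k) = gen_val (GZ (Suc k))"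
  "circ (GZ k) GXi = gen_val (GZ (Suc k))"
  "circ GXi GXi = gen_val (GZ 1) - hbar * gen_val GXi"
  by (simp_all add: numeral_2_eq_2)

text \<open>The first and the third identity rest on q^n + (1-q)[n] = 1; this is the source of the
  hbar terms in \<open>circ\<close>.\<close>

lemma Igen_circ:
  assumes "n > 0"
  shows "Igen q (GZ (Suc (k + l))) n + (1 - q) * Igen q (GZ (k + l)) n
      = Igen q (GZ k) n * Igen q (GZ l) n"
    "Igen q (GZ (Suc k)) n = Igen q GXi n * Igen q (GZ k) n"
    "Igen q (GZ 1) n - (1 - q) * Igen q GXi n = Igen q GXi n * Igen q GXi n"
proof -
  have n: "qnum q n \<noteq> 0" using qnum_ne_0 assms by simp
  have Q: "q ^ n + (1 - q) * qnum q n = 1" using q_power_eq [of n] by simp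
  have "Igen q (GZ (Suc (k + l))) n + (1 - q) * Igen q (GZ (k + l)) n
      = (q ^ n + (1 - q) * qnum q n) * (q ^ ((k + l) * n) / qnum q n ^ (k + l + 2))"
    using n by (simp add: field_simps power_add)
  then show "Igen q (GZ (Suc (k + l))) n + (1 - q) * Igen q (GZ (k + l)) n
      = Igen q (GZ k) n * Igen q (GZ l) n"
    unfolding Q using n by (simp add: field_simps power_add)
  show "Igen q (GZ (Suc k)) n = Igen q GXi n * Igen q (GZ k) n"
    by (simp add: power_add)
  have "Igen q (GZ 1) n - (1 - q) * Igen q GXi n
      = (1 - (1 - q) * qnum q n) * (q ^ n / qnum q n ^ 2)"
    using n by (simp add: field_simps power2_eq_square)
  then show "Igen q (GZ 1) n - (1 - q) * Igen q GXi n = Igen q GXi n * Igen q GXi n"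
    unfolding q_power_eq [symmetric] by (simp add: power2_eq_square)
qed

text \<open>\<open>circ\<close> is made such that its coefficient at n is the product of the two
  values of \<open>Igen\<close>. Hence \<open>circ a b\<close> obeys the same recursion in N as a
  single generator.\<close>

lemma psum_circ:
  "psum q 0 (circ a b * f) = 0"
  "psum q (Suc N) (circ a b * f)
     = psum q N (circ a b * f) + Igen q a (Suc N) * Igen q b (Suc N) * psum q N f"
proof -
  note gen = circ_gen_val distrib_right left_diff_distrib mult.assoc psum_add psum_diff psum_hbar
    psum_gen_val
  show "psum q 0 (circ a b * f) = 0"
    by (cases a; cases b) (simp_all only: gen, simp_all)
  have I: "r * t = c \<Longrightarrow> r * t * psum q N f = c * psum q N f" for r t c :: complex by simp
  show "psum q (Suc N) (circ a b * f)
     = psum q N (circ a b * f) + Igen q a (Suc N) * Igen q b (Suc N) * psum q N f"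
  proof (cases a; cases b)
    fix k l assume "a = GZ k" "b = GZ l"
    then show ?thesis using I [OF Igen_circ(1) [OF zero_less_Suc, of k l N, symmetric]]
      by (simp only: gen) (simp only: algebra_simps)
  next
    fix k assume "a = GZ k" "b = GXi"
    then show ?thesis using Igen_circ(2) [OF zero_less_Suc, of k N]
      by (simp only: gen mult.commute mult.left_commute)
  next
    fix k assume "a = GXi" "b = GZ k"
    then show ?thesis using Igen_circ(2) [OF zero_less_Suc, of k N]
      by (simp only: gen mult.commute mult.left_commute)
  next
    assume "a = GXi" "b = GXi"
    then show ?thesis using I [OF Igen_circ(3) [OF zero_less_Suc, of N, symmetric]]
      by (simp only: gen) (simp only: algebra_simps)
  qed
qed

lemma psum_1: "psum q N 1 = 1"
proof -
  have "gser q 1 = 1" using gser_single [of q "[]" 1] by simp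
  then have "psum q N 1 = (\<Sum>n\<le>N. if n = 0 then 1 else 0)" by (simp add: psum_def)
  then show ?thesis by simp
qed

text \<open>When N grows by one, each factor gains one term. In the product (A + a A')(B + b B') the
  three summands besides A B are the increments of the three summands of the
  \<open>star_word\<close> recursion. The outer hypotheses are used for arbitrary N.\<close>

lemma psum_star_word: "psum q N (star_word u v) = psum q N (gen_word u) * psum q N (gen_word v)"
proof (induction u v arbitrary: N rule: star_word.induct)
  case (3 a u b v)
  let ?s = "\<lambda>u v. star_word u v"
  have gw: "gen_word (c # w) = gen_val c * gen_word w" for c w by (simp add: gen_word_def)
  show ?case
  proof (induction N)
    case 0
    show ?case by (simp add: gw psum_add psum_gen_val psum_circ del: gen_val.simps circ.simps)
  next
    case (Suc N)
    have "psum q (Suc N) (?s (a # u) (b # v)) = psum q N (?s (a # u) (b # v))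
        + Igen q a (Suc N) * psum q N (?s u (b # v)) + Igen q b (Suc N) * psum q N (?s (a # u) v)
        + Igen q a (Suc N) * Igen q b (Suc N) * psum q N (?s u v)"
      by (simp add: psum_add psum_gen_val psum_circ del: gen_val.simps circ.simps Igen.simps)
    also have "\<dots> = (psum q N (gen_word (a # u)) + Igen q a (Suc N) * psum q N (gen_word u)) *
        (psum q N (gen_word (b # v)) + Igen q b (Suc N) * psum q N (gen_word v))"
      unfolding Suc 3 by (simp only: algebra_simps)
    finally show ?case by (simp add: gw psum_gen_val del: gen_val.simps Igen.simps)
  qed
qed (simp_all add: gen_word_def psum_1)

lemma psum_star:
  assumes "f \<in> H1" "g \<in> H1"
  shows "psum q N (star f g) = psum q N f * psum q N g"
proof -
  have "psum q N h = (\<Sum>w\<in>Poly_Mapping.keys (coords h).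
      ceval q (Poly_Mapping.lookup (coords h) w) * psum q N (gen_word w))" if "h \<in> H1" for h
    using psum_lin_ext [of N gen_word "coords h"] by (simp add: lin_ext_coords that)
  note this [OF assms(1)] this [OF assms(2)]
  moreover have "psum q N (star f g) =
      (\<Sum>u\<in>Poly_Mapping.keys (coords f). \<Sum>v\<in>Poly_Mapping.keys (coords g).
        (ceval q (Poly_Mapping.lookup (coords f) u) * psum q N (gen_word u)) *
        (ceval q (Poly_Mapping.lookup (coords g) v) * psum q N (gen_word v)))"
    unfolding star_def psum_lin_ext psum_star_word sum_distrib_left
    by (intro sum.cong refl) (simp add: mult_ac)
  ultimately show ?thesis by (simp add: sum_product)
qed

end

section \<open>Convergence\<close>

text \<open>Index lists of length \<open>r\<close> sorted by their largest entry \<open>n\<close>.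
  The empty list counts as having largest entry 0, in agreement with the series 1 of the empty
  word.\<close>

definition chains :: "nat \<Rightarrow> nat \<Rightarrow> nat list set" where
  "chains r n = {ns. length ns = r \<and> sorted_wrt (>) ns \<and> (\<forall>m\<in>set ns. m > 0) \<and>
     (case ns of [] \<Rightarrow> 0 | m # _ \<Rightarrow> m) = n}"

lemma chains_0: "chains 0 n = (if n = 0 then {[]} else {})"
  by (auto simp: chains_def)

lemma chains_Suc: "chains (Suc r) n = (if n = 0 then {} else \<Union>m<n. (#) n ` chains r m)"
proof (cases "n = 0")
  case True
  then show ?thesis by (auto simp: chains_def length_Suc_conv)
next
  case False
  have "ns \<in> chains (Suc r) n \<longleftrightarrow> ns \<in> (\<Union>m<n. (#) n ` chains r m)" for ns
  proof
    assume ns: "ns \<in> chains (Suc r) n"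
    then obtain ms where ms: "ns = n # ms" "length ms = r"
      by (auto simp: chains_def length_Suc_conv)
    then have "ms \<in> chains r (case ms of [] \<Rightarrow> 0 | m # _ \<Rightarrow> m)"
      using ns by (auto simp: chains_def)
    moreover have "(case ms of [] \<Rightarrow> 0 | m # _ \<Rightarrow> m) < n"
      using ns False ms by (auto simp: chains_def split: list.splits)
    ultimately show "ns \<in> (\<Union>m<n. (#) n ` chains r m)" using ms by blast
  next
    assume "ns \<in> (\<Union>m<n. (#) n ` chains r m)"
    then obtain m ms where ms: "ns = n # ms" "m < n" "ms \<in> chains r m" by blast
    then have "k < n" if "k \<in> set ms" for k
      using that by (cases ms) (auto simp: chains_def)
    then show "ns \<in> chains (Suc r) n" using ms False by (auto simp: chains_def)
  qed
  with False show ?thesis by auto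
qed

lemma finite_chains: "finite (chains r n)"
  by (induction r arbitrary: n) (auto simp: chains_0 chains_Suc)

lemma chains_disjoint: "m \<noteq> n \<Longrightarrow> chains r m \<inter> chains r n = {}"
  by (auto simp: chains_def)

text \<open>\<open>J\<close> is kept general so that one recursion serves both \<open>Igen q\<close>
  and its norms.\<close>

definition chain_sum :: "(gen \<Rightarrow> nat \<Rightarrow> 'a) \<Rightarrow> gen list \<Rightarrow> nat \<Rightarrow> 'a::comm_ring_1" where
  "chain_sum J w n = (\<Sum>ns\<in>chains (length w) n. \<Prod>i<length w. J (w ! i) (ns ! i))"

lemma chain_sum_Nil: "chain_sum J [] n = (if n = 0 then 1 else 0)"
  by (simp add: chain_sum_def chains_0)

lemma chain_sum_Cons:
  "chain_sum J (a # w) n = (if n = 0 then 0 else J a n * (\<Sum>m<n. chain_sum J w m))"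
proof (cases "n = 0")
  case False
  let ?p = "\<lambda>w ns. \<Prod>i<length w. J (w ! i) (ns ! i)"
  have "chain_sum J (a # w) n = (\<Sum>ns\<in>(\<Union>m<n. (#) n ` chains (length w) m). ?p (a # w) ns)"
    using False by (simp add: chain_sum_def chains_Suc)
  also have "\<dots> = (\<Sum>m<n. \<Sum>ns\<in>(#) n ` chains (length w) m. ?p (a # w) ns)"
    by (rule sum.UNION_disjoint) (use chains_disjoint in \<open>auto simp: finite_chains\<close>)
  also have "\<dots> = (\<Sum>m<n. \<Sum>ns\<in>chains (length w) m. J a n * ?p w ns)"
    by (simp add: sum.reindex prod.lessThan_Suc_shift del: prod.lessThan_Suc)
  finally show ?thesis using False by (simp add: chain_sum_def sum_distrib_left)
qed (simp add: chain_sum_def chains_Suc)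

lemma norm_chain_sum_le:
  fixes J :: "gen \<Rightarrow> nat \<Rightarrow> complex"
  shows "norm (chain_sum J w n) \<le> chain_sum (\<lambda>a n. norm (J a n)) w n"
  unfolding chain_sum_def by (rule sum_norm_le) (simp add: prod_norm)

context
  fixes q :: complex
  assumes q_pos: "0 < cmod q" and q_less: "cmod q < 1"
begin

lemma gser_gen_word: "fps_nth (gser q (gen_word w)) n = chain_sum (Igen q) w n"
proof (induction w arbitrary: n)
  case Nil
  show ?case using gser_single [of q "[]" 1] by (simp add: gen_word_def chain_sum_Nil)
next
  case (Cons a w)
  have "gen_word (a # w) = gen_val a * gen_word w" by (simp add: gen_word_def)
  then show ?case using Cons gser_gen_val [OF q_pos q_less, of a "gen_word w" n]
    by (simp add: chain_sum_Cons del: gen_val.simps Igen.simps)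
qed

text \<open>Every generator except z 1 has at least one factor q^n in its numerator, and the
  denominators stay away from 0.\<close>

lemma Igen_bound:
  "\<exists>D\<ge>0. \<forall>n>0. norm (Igen q a n) \<le> D * (if a = GZ 0 then 1 else norm q ^ n)"
proof -
  \<comment> \<open>A lower bound for |[n]|, from |1 - q^n| >= 1 - |q|^n >= 1 - |q|.\<close>
  define \<delta> where "\<delta> = (1 - norm q) / norm (1 - q)"
  have "\<delta> > 0" unfolding \<delta>_def using q_less by (auto intro!: divide_pos_pos)
  have qnum: "\<delta> \<le> norm (qnum q n)" if "n > 0" for n
  proof -
    have "norm q ^ n \<le> norm q" using that q_less power_decreasing [of 1 n "norm q"] by simp
    moreover have "1 - norm q ^ n \<le> norm (1 - q ^ n)"
      using norm_triangle_ineq2 [of 1 "q ^ n"] by (simp add: norm_power)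
    ultimately show ?thesis
      unfolding \<delta>_def qnum_def norm_divide by (intro divide_right_mono) auto
  qed
  define r where "r = (case a of GXi \<Rightarrow> 1 | GZ k \<Rightarrow> Suc k)"
  show ?thesis
  proof (intro exI [of _ "1 / \<delta> ^ r"] conjI allI impI)
    fix n :: nat assume n: "n > 0"
    define num where "num = (case a of GXi \<Rightarrow> q ^ n | GZ k \<Rightarrow> q ^ (k * n))"
    have I: "Igen q a n = num / qnum q n ^ r"
      by (cases a) (simp_all add: num_def r_def)
    have num: "norm num \<le> (if a = GZ 0 then 1 else norm q ^ n)"
    proof (cases a)
      case (GZ k)
      show ?thesis
      proof (cases "k = 0")
        case False
        then have "norm q ^ (k * n) \<le> norm q ^ n"
          using q_less by (intro power_decreasing) auto
        then show ?thesis using GZ False by (simp add: num_def norm_power)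
      qed (simp add: num_def GZ)
    qed (simp add: num_def norm_power)
    have "norm (Igen q a n) \<le> norm num / \<delta> ^ r"
      unfolding I norm_divide norm_power using qnum [OF n] \<open>\<delta> > 0\<close>
      by (intro divide_left_mono power_mono mult_pos_pos zero_less_power) auto
    also have "\<dots> \<le> (if a = GZ 0 then 1 else norm q ^ n) / \<delta> ^ r"
      using num \<open>\<delta> > 0\<close> by (intro divide_right_mono) auto
    finally show "norm (Igen q a n) \<le> 1 / \<delta> ^ r * (if a = GZ 0 then 1 else norm q ^ n)"
      by simp
  qed (use \<open>\<delta> > 0\<close> in simp)
qed

lemma chain_sum_norm_nonneg: "0 \<le> chain_sum (\<lambda>a n. norm (Igen q a n)) w n"
  unfolding chain_sum_def by (intro sum_nonneg prod_nonneg) auto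

text \<open>The sum of s^m over m < n is at most s^n/(s-1), so summation preserves the growth rate
  s, and a new letter other than z 1 multiplies the rate by |q|.\<close>

lemma chain_sum_bound_Cons:
  assumes "s > 1" "C \<ge> 0" and C: "\<And>n. chain_sum (\<lambda>a n. norm (Igen q a n)) w n \<le> C * s ^ n"
  shows "\<exists>C'\<ge>0. \<forall>n. chain_sum (\<lambda>a n. norm (Igen q a n)) (a # w) n
    \<le> C' * ((if a = GZ 0 then 1 else norm q) * s) ^ n"
proof -
  let ?P = "chain_sum (\<lambda>a n. norm (Igen q a n))"
  obtain D where D: "D \<ge> 0"
    "\<And>n. n > 0 \<Longrightarrow> norm (Igen q a n) \<le> D * (if a = GZ 0 then 1 else norm q ^ n)"
    using Igen_bound [of a] by blast
  show ?thesis
  proof (intro exI [of _ "D * C / (s - 1)"] conjI allI)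
    show "0 \<le> D * C / (s - 1)" using D assms by simp
    then show "?P (a # w) n \<le> D * C / (s - 1) * ((if a = GZ 0 then 1 else norm q) * s) ^ n" for n
    proof (cases "n = 0")
      case False
      have "(\<Sum>m<n. ?P w m) \<le> (\<Sum>m<n. C * s ^ m)" by (intro sum_mono C)
      also have "\<dots> = C * ((s ^ n - 1) / (s - 1))"
        using assms by (simp add: geometric_sum flip: sum_distrib_left)
      also have "\<dots> \<le> C * (s ^ n / (s - 1))"
        using assms by (intro mult_left_mono divide_right_mono) auto
      finally have "(\<Sum>m<n. ?P w m) \<le> C * (s ^ n / (s - 1))" .
      moreover have "0 \<le> (\<Sum>m<n. ?P w m)"
        by (intro sum_nonneg chain_sum_norm_nonneg)
      ultimately have "norm (Igen q a n) * (\<Sum>m<n. ?P w m)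
          \<le> (D * (if a = GZ 0 then 1 else norm q ^ n)) * (C * (s ^ n / (s - 1)))"
        using D False by (intro mult_mono) auto
      then show ?thesis using False
        by (simp add: chain_sum_Cons power_mult_distrib mult_ac split: if_splits del: Igen.simps)
    qed (simp add: chain_sum_Cons)
  qed
qed

text \<open>Coefficients of words grow subexponentially: the base \<open>s\<close> is arbitrarily close to 1.\<close>

lemma chain_sum_bound:
  assumes "s > 1"
  shows "\<exists>C\<ge>0. \<forall>n. chain_sum (\<lambda>a n. norm (Igen q a n)) w n \<le> C * s ^ n"
proof (induction w)
  case Nil
  show ?case by (rule exI [of _ 1]) (use assms in \<open>auto simp: chain_sum_Nil\<close>)
next
  case (Cons a w)
  then obtain C where "C \<ge> 0" "\<And>n. chain_sum (\<lambda>a n. norm (Igen q a n)) w n \<le> C * s ^ n"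
    by blast
  with assms obtain C' where C': "C' \<ge> 0" "\<And>n. chain_sum (\<lambda>a n. norm (Igen q a n)) (a # w) n
      \<le> C' * ((if a = GZ 0 then 1 else norm q) * s) ^ n"
    using chain_sum_bound_Cons [of s _ _ a] by blast
  have "((if a = GZ 0 then 1 else norm q) * s) ^ n \<le> s ^ n" for n
    using assms q_less by (intro power_mono) (auto simp: mult_left_le_one_le)
  with C' show ?case by (meson mult_left_mono order_trans)
qed

text \<open>The tail grows at most like s^n for any chosen s > 1. With s < 1/|q| the factor |q|^n of
  the admissible first letter turns this into a convergent geometric bound.\<close>

lemma chain_sum_summable:
  assumes "adm_word w"
  shows "summable (chain_sum (\<lambda>a n. norm (Igen q a n)) w)"
proof (cases w)
  case Nil
  have "chain_sum (\<lambda>a n. norm (Igen q a n)) w = (\<lambda>n. if n = 0 then 1 else 0)"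
    by (rule ext) (simp add: Nil chain_sum_Nil)
  then show ?thesis by simp
next
  case (Cons a v)
  have "1 < 1 / norm q" using q_pos q_less by simp
  then obtain s where s: "1 < s" "s < 1 / norm q" using dense by blast
  then have qs: "norm q * s < 1" using q_pos by (simp add: field_simps)
  obtain C where "C \<ge> 0" "\<And>n. chain_sum (\<lambda>a n. norm (Igen q a n)) v n \<le> C * s ^ n"
    using chain_sum_bound [OF s(1)] by blast
  with s(1) obtain C' where C': "C' \<ge> 0" "\<And>n. chain_sum (\<lambda>a n. norm (Igen q a n)) (a # v) n
      \<le> C' * ((if a = GZ 0 then 1 else norm q) * s) ^ n"
    using chain_sum_bound_Cons [of s _ _ a] by blast
  have a: "a \<noteq> GZ 0" using assms Cons by simp
  show ?thesis
  proof (rule summable_comparison_test')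
    show "summable (\<lambda>n. C' * (norm q * s) ^ n)"
      using qs q_pos s by (intro summable_mult summable_geometric) simp
    show "norm (chain_sum (\<lambda>a n. norm (Igen q a n)) w n) \<le> C' * (norm q * s) ^ n" for n
      using C'(2) [of n] a chain_sum_norm_nonneg [of w n] by (simp add: Cons)
  qed
qed

lemma chain_sum_norm_summable:
  "adm_word w \<Longrightarrow> summable (\<lambda>n. norm (chain_sum (Igen q) w n))"
  by (rule summable_comparison_test' [OF chain_sum_summable])
    (use norm_chain_sum_le in auto)

text \<open>The sum over all index lists is regrouped by the largest index. The groups are finite,
  and absolute summability of the family indexed by pairs of largest index and list justifies the
  regrouping.\<close>

lemma Zword_sums:
  assumes "adm_word w"
  shows "chain_sum (Igen q) w sums Zword q w"
proof -
  define A where "A = {ns. length ns = length w \<and> sorted_wrt (>) ns \<and> (\<forall>n\<in>set ns. n > (0::nat))}"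
  define f where "f ns = (\<Prod>i<length w. Igen q (w ! i) (ns ! i))" for ns
  let ?S = "Sigma UNIV (chains (length w))"
  have "(\<lambda>p. norm (f (snd p))) summable_on ?S"
    unfolding Infinite_Sum.abs_summable_on_Sigma_iff
  proof (intro conjI ballI)
    show "(\<lambda>ns. norm (f (snd (n, ns)))) summable_on chains (length w) n" for n
      by (intro summable_on_finite finite_chains)
    have "(\<Sum>\<^sub>\<infinity>ns\<in>chains (length w) n. norm (f (snd (n, ns))))
        = chain_sum (\<lambda>a n. norm (Igen q a n)) w n" for n
      by (simp add: finite_chains chain_sum_def f_def prod_norm)
    moreover have "chain_sum (\<lambda>a n. norm (Igen q a n)) w summable_on UNIV"
      using chain_sum_summable [OF assms] chain_sum_norm_nonneg
      by (subst summable_on_UNIV_nonneg_real_iff) auto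
    ultimately show "(\<lambda>n. norm (\<Sum>\<^sub>\<infinity>ns\<in>chains (length w) n. norm (f (snd (n, ns)))))
        summable_on UNIV"
      using chain_sum_norm_nonneg by simp
  qed
  then have "(\<lambda>p. f (snd p)) summable_on ?S" by (rule Infinite_Sum.abs_summable_summable)
  then have "(\<Sum>\<^sub>\<infinity>n. \<Sum>\<^sub>\<infinity>ns\<in>chains (length w) n. f ns) = (\<Sum>\<^sub>\<infinity>p\<in>?S. f (snd p))"
    using infsum_Sigma_banach [of "\<lambda>p. f (snd p)" UNIV "chains (length w)"] by simp
  also have "\<dots> = (\<Sum>\<^sub>\<infinity>ns\<in>A. f ns)"
  proof (rule infsum_reindex_bij_betw)
    show "bij_betw snd ?S A"
      by (rule bij_betw_byWitness [where f' = "\<lambda>ns. (case ns of [] \<Rightarrow> 0 | m # _ \<Rightarrow> m, ns)"])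
        (auto simp: chains_def A_def)
  qed
  also have "\<dots> = Zword q w" by (simp add: Zword_def A_def f_def)
  finally have "(\<Sum>\<^sub>\<infinity>n. chain_sum (Igen q) w n) = Zword q w"
    by (simp add: finite_chains chain_sum_def f_def)
  moreover have "(chain_sum (Igen q) w has_sum suminf (chain_sum (Igen q) w)) UNIV"
    using chain_sum_norm_summable [OF assms]
    by (rule norm_summable_imp_has_sum [OF _ summable_sums [OF summable_norm_cancel]]) fact
  ultimately show ?thesis by (metis has_sum_imp_sums infsumI)
qed

text \<open>\<open>Zq\<close> is a finite combination of values \<open>Zword\<close>, and by
  \<open>coords_H0hat\<close> only admissible words occur in it. The absolute version is what the
  Cauchy product needs.\<close>

lemma Zq_sums:
  assumes "f \<in> H0hat"
  shows "fps_nth (gser q f) sums Zq q f" "summable (\<lambda>n. norm (fps_nth (gser q f) n))"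
proof -
  let ?K = "Poly_Mapping.keys (coords f)" and ?c = "\<lambda>w. ceval q (Poly_Mapping.lookup (coords f) w)"
  have f: "fps_nth (gser q f) n = (\<Sum>w\<in>?K. ?c w * chain_sum (Igen q) w n)" for n
    using gser_lin_ext [of q gen_word "coords f"]
    by (simp add: lin_ext_coords [OF H0hat_subset_H1 [OF assms]] fps_sum_nth gser_gen_word)
  have adm: "adm_word w" if "w \<in> ?K" for w
    using coords_H0hat [OF assms] that by (auto simp: words_in_def)
  show "fps_nth (gser q f) sums Zq q f"
    unfolding f [abs_def] Zq_def by (intro sums_sum sums_mult Zword_sums adm)
  show "summable (\<lambda>n. norm (fps_nth (gser q f) n))"
  proof (rule summable_comparison_test')
    show "summable (\<lambda>n. \<Sum>w\<in>?K. norm (?c w) * norm (chain_sum (Igen q) w n))"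
      by (intro summable_sum summable_mult chain_sum_norm_summable adm)
    show "norm (norm (fps_nth (gser q f) n))
        \<le> (\<Sum>w\<in>?K. norm (?c w) * norm (chain_sum (Igen q) w n))" for n
      unfolding f by (simp add: sum_norm_le norm_mult)
  qed
qed

section \<open>Multiplicativity and linearity of \<open>Zq\<close> on \<open>H0hat\<close>\<close>

lemma Zq_sh:
  assumes "f \<in> H0hat" "g \<in> H0hat"
  shows "Zq q (sh f g) = Zq q f * Zq q g"
proof -
  have "(\<lambda>n. \<Sum>i\<le>n. fps_nth (gser q f) i * fps_nth (gser q g) (n - i)) sums
      (suminf (fps_nth (gser q f)) * suminf (fps_nth (gser q g)))"
    by (intro Cauchy_product_sums Zq_sums assms)
  moreover have "fps_nth (gser q (sh f g)) =
      (\<lambda>n. \<Sum>i\<le>n. fps_nth (gser q f) i * fps_nth (gser q g) (n - i))"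
    using gser_sh [OF q_pos q_less] assms [THEN H0hat_subset_H1]
    by (auto simp: fps_mult_nth atMost_atLeast0)
  ultimately show ?thesis
    using Zq_sums(1) [OF sh_H0hat [OF assms]] Zq_sums(1) assms by (metis sums_unique)
qed

lemma psum_tendsto:
  assumes "f \<in> H0hat" shows "(\<lambda>N. psum q N f) \<longlonglongrightarrow> Zq q f"
  using Zq_sums(1) [OF assms] by (simp add: sums_def_le psum_def)

lemma Zq_star:
  assumes "f \<in> H0hat" "g \<in> H0hat"
  shows "Zq q (star f g) = Zq q f * Zq q g"
proof -
  have "(\<lambda>N. psum q N f * psum q N g) \<longlonglongrightarrow> Zq q f * Zq q g"
    by (intro tendsto_mult psum_tendsto assms)
  then show ?thesis
    using psum_tendsto [OF star_H0hat [OF assms]] psum_star [OF q_pos q_less]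
      assms [THEN H0hat_subset_H1]
    by (simp add: LIMSEQ_unique)
qed

text \<open>Read off from uniqueness of limits, since \<open>gser\<close> is additive by
  construction whereas \<open>Zq\<close> is defined through the inverse map
  \<open>coords\<close>.\<close>

lemma Zq_add:
  assumes "f \<in> H0hat" "g \<in> H0hat"
  shows "Zq q (f + g) = Zq q f + Zq q g"
proof -
  have "fps_nth (gser q (f + g)) = (\<lambda>n. fps_nth (gser q f) n + fps_nth (gser q g) n)"
    by (rule ext) (simp add: gser_add)
  then show ?thesis
    using sums_add [OF assms [THEN Zq_sums(1)]] sums_unique2
      Zq_sums(1) [OF submodule_add [OF submodule_H0hat assms]] by metis
qed

lemma Zq_cst:
  assumes "f \<in> H0hat"
  shows "Zq q (cst c * f) = ceval q c * Zq q f"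
  using sums_mult [OF Zq_sums(1) [OF assms]] Zq_sums(1) [OF submodule_cst [OF submodule_H0hat assms]]
  by (metis (no_types, lifting) ext fps_mult_left_const_nth gser_cst sums_unique2)

lemma Zq_star_minus_sh:
  assumes "f \<in> H0hat" "g \<in> H0hat"
  shows "Zq q (star f g - sh f g) = 0"
proof -
  have "star f g - sh f g \<in> H0hat"
    by (intro submodule_diff submodule_H0hat star_H0hat sh_H0hat assms)
  from Zq_add [OF this sh_H0hat [OF assms]] show ?thesis
    by (simp add: Zq_star Zq_sh assms)
qed

end

theorem theorem3:
  fixes q :: complex and d :: nat
  assumes "0 < cmod q" and "cmod q < 1"
  shows "S_space d \<subseteq> ker_Zbar q"
proof -
  \<comment> \<open>Within a single weight \<open>Zbar\<close> is \<open>Zq\<close> divided by a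
    fixed power of 1 - q, so a subspace of this component can be handled by linearity of
    \<open>Zq\<close> alone.\<close>
  define K where "K = {f \<in> H0hat_wt d. Zq q f = 0}"
  have "HQ.subspace K"
    unfolding HQ.subspace_def
  proof (intro conjI ballI allI)
    show "0 \<in> K"
      using Zq_cst [OF assms, of 0 0] submodule_0 [OF submodule_H0hat]
      by (simp add: K_def H0hat_wt_iff homogeneous_0)
  next
    fix f g assume "f \<in> K" "g \<in> K"
    then show "f + g \<in> K"
      using Zq_add [OF assms]
      by (auto simp: K_def H0hat_wt_iff intro: homogeneous_add submodule_add submodule_H0hat)
  next
    fix c f assume "f \<in> K"
    moreover have "homogeneous 0 (cst [:c:])"
      using homogeneous_monom [of "[]" 0 c] by (simp add: cst_def monom_0)
    ultimately show "qscale c f \<in> K"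
      using Zq_cst [OF assms] homogeneous_mult [of 0 "cst [:c:]" d f]
      by (auto simp: K_def H0hat_wt_iff qscale_def intro: submodule_cst submodule_H0hat)
  qed
  \<comment> \<open>Both products add weights, so the difference stays in weight \<open>d\<close>,
    and there the two values of \<open>Zq\<close> agree as products.\<close>
  moreover have "star w w' - sh w w' \<in> K"
    if "w \<in> H0hat_wt a" "w' \<in> H0hat_wt b" "a + b = d" for w w' a b
    using that Zq_star_minus_sh [OF assms]
    by (auto simp: K_def H0hat_wt_iff intro!: homogeneous_diff homogeneous_star homogeneous_sh
        submodule_diff submodule_H0hat star_H0hat sh_H0hat H0hat_subset_H1)
  ultimately have "S_space d \<subseteq> K"
    unfolding S_space_def by (intro HQ.span_minimal) auto
  moreover have "K \<subseteq> ker_Zbar q"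
    by (auto simp: K_def ker_Zbar_def H0hat_wt_iff Zbar_homogeneous)
  ultimately show ?thesis by blast
qed

end
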